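(* Let $n\ge k$ be positive integers. Then \[ c_{n,k}(x)=\sum_{i=0}^k(-1)^{k-i}\,\mathrm{ch}(C_i)=\mathrm{ch}(H_k), \] where $C_i=C_i([k],[n-k+1])$ and $H_k$ is the degree-$k$ homology of the chain complex $(C_*([k],[n-k+1]),\partial)$ of $\mathfrak S_k$-modules.
   Context: $c_{n,k}(x)$ is the symmetric function $\sum_{i=0}^k(-1)^{k-i}\binom{n-k+i}{i}s_{(1^{k-i})}s_{(1)}^i$ in infinitely many variables, with $s_\rho$ Schur functions. For finite nonempty sets of integers $A,M$, $\Delta_i(A,M)$ is the set of pairs $(w,S)$ where $w=w_1\cdots w_i$ is an injective word of length $i$ on alphabet $A$ (a sequence of distinct elements of $A$) and $S=(j_1,\dots,j_i)$ is a weakly increasing sequence of length $i$ of elements of $M$; $C_i(A,M)$ is the complex vector space with basis $\Delta_i(A,M)$ (so $C_0$ is spanned by the pair of empty sequences). The differential $\partial_i:C_i(A,M)\to C_{i-1}(A,M)$ is $\partial_i(w_1\cdots w_i,(j_1,\dots,j_i))=\sum_{l=1}^i(-1)^{l-1}(w_1\cdots\widehat{w_l}\cdots w_i,(j_1,\dots,\widehat{j_l},\dots,j_i))$. $\mathfrak S_k$ acts on $C_i([k],[n-k+1])$ by $\sigma\cdot(w_1\cdots w_i,S)=\mathrm{sign}(\sigma)(\sigma(w_1)\cdots\sigma(w_i),S)$; the maps $\partial_i$ are equivariant. $\mathrm{ch}$ denotes the Frobenius characteristic of an $\mathfrak S_k$-module: $\mathrm{ch}(V)=\sum_{\rho\vdash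 k}z_\rho^{-1}\chi_V(\rho)p_\rho$, with $p_\rho$ power sum symmetric functions and $z_\rho=k!/(\text{number of permutations of cycle type }\rho)$. *)

theory Defs
  imports
    "HOL-Library.Poly_Mapping"
    "HOL-Library.FuncSet"
    "HOL-Combinatorics.Permutations"
    "HOL-Combinatorics.Orbits"
    "HOL-Algebra.AbelCoset"
    "Jordan_Normal_Form.VS_Connect"
begin

section \<open>Formal power series in infinitely many variables\<close>

text \<open>
  Symmetric functions in the variables \<open>x\<^sub>0, x\<^sub>1, x\<^sub>2, \<dots>\<close> are infinite sums of monomials, so they are
  represented as formal power series: arbitrary functions from monomials (finitely supported
  exponent vectors) to coefficients.  The ring of symmetric functions is a subring of this ring.
\<close>

typedef 'a mfps = "UNIV :: ((nat \<Rightarrow>\<^sub>0 nat) \<Rightarrow> 'a) set"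
  morphisms mcoeff Abs_mfps
  by simp

lemma mcoeff_Abs [simp]: "mcoeff (Abs_mfps f) m = f m"
  by (simp add: Abs_mfps_inverse)

lemma mfps_eqI: "(\<And>m. mcoeff f m = mcoeff g m) \<Longrightarrow> f = g"
  by (metis ext mcoeff_inject)

definition msplits :: "(nat \<Rightarrow>\<^sub>0 nat) \<Rightarrow> ((nat \<Rightarrow>\<^sub>0 nat) \<times> (nat \<Rightarrow>\<^sub>0 nat)) set" where
  "msplits m = {(a, b). a + b = m}"

lemma finite_msplits [simp]: "finite (msplits m)"
proof -
  define N where "N = (\<Sum>j\<in>Poly_Mapping.keys m. Poly_Mapping.lookup m j)"
  let ?F = "{f :: nat \<Rightarrow> nat. \<forall>i. (i \<in> Poly_Mapping.keys m \<longrightarrow> f i \<in> {..N}) \<and> (i \<notin> Poly_Mapping.keys m \<longrightarrow> f i = 0)}"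
  have F: "finite ?F"
    by (rule finite_set_of_finite_funs) auto
  have mem: "Poly_Mapping.lookup (fst p) \<in> ?F" if "p \<in> msplits m" for p
  proof -
    have "fst p + snd p = m"
      using that by (simp add: msplits_def case_prod_unfold)
    then have l: "Poly_Mapping.lookup (fst p) i \<le> Poly_Mapping.lookup m i" for i
      using lookup_add[of "fst p" "snd p" i] by simp
    have "Poly_Mapping.lookup (fst p) i \<le> N" if "i \<in> Poly_Mapping.keys m" for i
    proof (rule order_trans[OF l])
      show "Poly_Mapping.lookup m i \<le> N"
        unfolding N_def by (rule member_le_sum[OF that]) simp_all
    qed
    moreover have "Poly_Mapping.lookup (fst p) i = 0" if "i \<notin> Poly_Mapping.keys m" for i
      using l[of i] that by (simp add: in_keys_iff)
    ultimately show ?thesis by simp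
  qed
  have "inj_on (\<lambda>p. Poly_Mapping.lookup (fst p)) (msplits m)"
  proof (rule inj_onI)
    fix p q
    assume p: "p \<in> msplits m" and q: "q \<in> msplits m" and eq: "Poly_Mapping.lookup (fst p) = Poly_Mapping.lookup (fst q)"
    have "fst p = fst q"
      by (rule iffD2[OF poly_mapping_eq_iff eq])
    moreover have "fst p + snd p = fst q + snd q"
      using p q by (simp add: msplits_def case_prod_unfold)
    ultimately show "p = q"
      by (simp add: prod_eq_iff)
  qed
  moreover have "finite ((\<lambda>p. Poly_Mapping.lookup (fst p)) ` msplits m)"
    by (rule finite_subset[OF _ F]) (rule image_subsetI, rule mem)
  ultimately show ?thesis
    by (rule finite_imageD[rotated])
qed

instantiation mfps :: (comm_ring_1) comm_ring_1
begin

definition "0 = Abs_mfps (\<lambda>_. 0)"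
definition "1 = Abs_mfps (\<lambda>m. if m = 0 then 1 else 0)"
definition "f + g = Abs_mfps (\<lambda>m. mcoeff f m + mcoeff g m)"
definition "- f = Abs_mfps (\<lambda>m. - mcoeff f m)"
definition "f - g = Abs_mfps (\<lambda>m. mcoeff f m - mcoeff g m)"
definition "f * g = Abs_mfps (\<lambda>m. \<Sum>(a, b)\<in>msplits m. mcoeff f a * mcoeff g b)"

lemmas mfps_defs = zero_mfps_def one_mfps_def plus_mfps_def uminus_mfps_def minus_mfps_def times_mfps_def

instance
proof
  fix f g h :: "'a mfps"
  show "f + g + h = f + (g + h)" "f + g = g + f" "0 + f = f" "- f + f = 0" "f - g = f + - g"
    by (auto intro!: mfps_eqI simp: mfps_defs algebra_simps)
  show "(0::'a mfps) \<noteq> 1"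
    by (metis mcoeff_Abs one_mfps_def zero_mfps_def zero_neq_one)
  show "f * g = g * f"
  proof (rule mfps_eqI)
    fix m
    show "mcoeff (f * g) m = mcoeff (g * f) m"
      unfolding times_mfps_def mcoeff_Abs
      by (rule sum.reindex_bij_witness[of _ prod.swap prod.swap])
        (auto simp: msplits_def algebra_simps)
  qed
  show "(f + g) * h = f * h + g * h"
    by (rule mfps_eqI)
      (simp add: times_mfps_def plus_mfps_def case_prod_unfold distrib_right sum.distrib)
  show "1 * f = f"
  proof (rule mfps_eqI)
    fix m
    have "mcoeff (1 * f) m = (\<Sum>x\<in>msplits m. if x = (0, m) then mcoeff f m else 0)"
      unfolding times_mfps_def mcoeff_Abs one_mfps_def
      by (rule sum.cong) (auto simp: msplits_def split: if_splits)
    also have "\<dots> = mcoeff f m"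
      by (subst sum.delta) (rule finite_msplits, simp add: msplits_def)
    finally show "mcoeff (1 * f) m = mcoeff f m" .
  qed
  show "f * g * h = f * (g * h)"
  proof (rule mfps_eqI)
    fix m
    have "mcoeff (f * g * h) m =
        (\<Sum>((s, c), (a, b))\<in>(SIGMA x:msplits m. msplits (fst x)). mcoeff f a * mcoeff g b * mcoeff h c)"
      by (simp add: times_mfps_def case_prod_unfold sum_distrib_right sum.Sigma)
    also have "\<dots> = (\<Sum>((a, s), (b, c))\<in>(SIGMA x:msplits m. msplits (snd x)).
        mcoeff f a * (mcoeff g b * mcoeff h c))"
      by (rule sum.reindex_bij_witness[of _
            "\<lambda>((a, s), (b, c)). ((a + b, c), (a, b))" "\<lambda>((s, c), (a, b)). ((a, b + c), (b, c))"])
        (auto simp: msplits_def algebra_simps)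
    also have "\<dots> = mcoeff (f * (g * h)) m"
      by (simp add: times_mfps_def case_prod_unfold sum_distrib_left sum.Sigma)
    finally show "mcoeff (f * g * h) m = mcoeff (f * (g * h)) m" .
  qed
qed

end

definition mscale :: "'a \<Rightarrow> 'a mfps \<Rightarrow> 'a::comm_ring_1 mfps" where
  "mscale c f = Abs_mfps (\<lambda>m. c * mcoeff f m)"


section \<open>Schur functions and power sums\<close>

definition partitions :: "nat \<Rightarrow> nat list set" where
  "partitions k = {\<rho>. sorted_wrt (\<ge>) \<rho> \<and> 0 \<notin> set \<rho> \<and> sum_list \<rho> = k}"

definition diagram :: "nat list \<Rightarrow> (nat \<times> nat) set" where
  "diagram \<rho> = {(r, c). r < length \<rho> \<and> c < \<rho> ! r}"

text \<open>Semistandard fillings; the entry \<open>i\<close> stands for the variable \<open>x\<^sub>i\<close>, so entries start at 0.\<close>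

definition ssyt :: "nat list \<Rightarrow> (nat \<times> nat \<Rightarrow> nat) set" where
  "ssyt \<rho> = {T \<in> extensional (diagram \<rho>).
     (\<forall>r c. (r, c) \<in> diagram \<rho> \<and> (r, Suc c) \<in> diagram \<rho> \<longrightarrow> T (r, c) \<le> T (r, Suc c)) \<and>
     (\<forall>r c. (r, c) \<in> diagram \<rho> \<and> (Suc r, c) \<in> diagram \<rho> \<longrightarrow> T (r, c) < T (Suc r, c))}"

definition schur :: "nat list \<Rightarrow> 'a::comm_ring_1 mfps" where
  "schur \<rho> = Abs_mfps (\<lambda>m.
     of_nat (card {T \<in> ssyt \<rho>. \<forall>i. card {u \<in> diagram \<rho>. T u = i} = Poly_Mapping.lookup m i}))"

definition power_sum :: "nat \<Rightarrow> 'a::comm_ring_1 mfps" where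
  "power_sum r = Abs_mfps (\<lambda>m. if \<exists>i. m = Poly_Mapping.single i r then 1 else 0)"

definition power_sums :: "nat list \<Rightarrow> 'a::comm_ring_1 mfps" where
  "power_sums \<rho> = prod_list (map power_sum \<rho>)"

definition c_fun :: "nat \<Rightarrow> nat \<Rightarrow> 'a::comm_ring_1 mfps" where
  "c_fun n k = (\<Sum>i=0..k. (-1) ^ (k - i) * of_nat ((n - k + i) choose i) *
     schur (replicate (k - i) 1) * schur [1] ^ i)"


section \<open>Frobenius characteristic\<close>

text \<open>The trace of an endomorphism does not depend on the basis chosen.\<close>

definition basis_coords :: "(complex, 'v) module \<Rightarrow> 'v set \<Rightarrow> 'v \<Rightarrow> 'v \<Rightarrow> complex" where
  "basis_coords V B v =
     (THE a. a \<in> B \<rightarrow>\<^sub>E carrier (class_ring :: complex ring) \<and> module.lincomb V a B = v)"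

definition vs_trace :: "(complex, 'v) module \<Rightarrow> ('v \<Rightarrow> 'v) \<Rightarrow> complex" where
  "vs_trace V \<phi> =
     (let B = (SOME B. finite B \<and> vectorspace.basis (class_ring :: complex ring) V B)
      in \<Sum>b\<in>B. basis_coords V B (\<phi> b) b)"

definition cycle_type :: "'a set \<Rightarrow> ('a \<Rightarrow> 'a) \<Rightarrow> nat list" where
  "cycle_type A \<sigma> = rev (sorted_list_of_multiset (image_mset card (mset_set (orbit \<sigma> ` A))))"

definition perms_of_type :: "nat \<Rightarrow> nat list \<Rightarrow> (int \<Rightarrow> int) set" where
  "perms_of_type k \<rho> = {\<sigma>. \<sigma> permutes {1..int k} \<and> cycle_type {1..int k} \<sigma> = \<rho>}"

definition z_num :: "nat \<Rightarrow> nat list \<Rightarrow> complex" where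
  "z_num k \<rho> = of_nat (fact k) / of_nat (card (perms_of_type k \<rho>))"

text \<open>
  A representation of the symmetric group on \<open>{1..k}\<close> is given by a complex vector space \<open>V\<close> together
  with the action \<open>act\<close> of each permutation.  The character is a class function, so its value at
  \<open>\<rho>\<close> is read off at any permutation of that cycle type.
\<close>

definition char_at :: "nat \<Rightarrow> (complex, 'v) module \<Rightarrow> ((int \<Rightarrow> int) \<Rightarrow> 'v \<Rightarrow> 'v) \<Rightarrow> nat list \<Rightarrow> complex" where
  "char_at k V act \<rho> = vs_trace V (act (SOME \<sigma>. \<sigma> \<in> perms_of_type k \<rho>))"

definition frob_ch :: "nat \<Rightarrow> (complex, 'v) module \<Rightarrow> ((int \<Rightarrow> int) \<Rightarrow> 'v \<Rightarrow> 'v) \<Rightarrow> complex mfps" where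
  "frob_ch k V act = (\<Sum>\<rho>\<in>partitions k. mscale (inverse (z_num k \<rho>) * char_at k V act \<rho>) (power_sums \<rho>))"


section \<open>The chain complex of injective words with labels\<close>

type_synonym cell = "int list \<times> int list"

definition Delta :: "int set \<Rightarrow> int set \<Rightarrow> nat \<Rightarrow> cell set" where
  "Delta A M i = {(w, S). length w = i \<and> distinct w \<and> set w \<subseteq> A \<and>
     length S = i \<and> sorted S \<and> set S \<subseteq> M}"

text \<open>The ring fields \<open>mult\<close> and \<open>one\<close> of a module record are never used.\<close>

definition chain_space :: "int set \<Rightarrow> int set \<Rightarrow> nat \<Rightarrow> (complex, cell \<Rightarrow>\<^sub>0 complex) module" where
  "chain_space A M i = \<lparr>carrier = {f. Poly_Mapping.keys f \<subseteq> Delta A M i}, mult = (\<lambda>_ _. 0), one = 0,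
     zero = 0, add = (+), smult = (\<lambda>c. Poly_Mapping.map ((*) c))\<rparr>"

definition delete_nth :: "nat \<Rightarrow> 'a list \<Rightarrow> 'a list" where
  "delete_nth l xs = take l xs @ drop (Suc l) xs"

text \<open>
  Positions are counted from 0, hence the sign \<open>(-1)^l\<close>.  One function serves as the differential in
  every degree; in degree 0 it is the zero map.
\<close>

definition boundary :: "(cell \<Rightarrow>\<^sub>0 complex) \<Rightarrow> (cell \<Rightarrow>\<^sub>0 complex)" where
  "boundary f = (\<Sum>(w, S)\<in>Poly_Mapping.keys f. \<Sum>l<length w.
     Poly_Mapping.single (delete_nth l w, delete_nth l S) ((-1) ^ l * Poly_Mapping.lookup f (w, S)))"

definition chain_act :: "(int \<Rightarrow> int) \<Rightarrow> (cell \<Rightarrow>\<^sub>0 complex) \<Rightarrow> (cell \<Rightarrow>\<^sub>0 complex)" where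
  "chain_act \<sigma> f = (\<Sum>(w, S)\<in>Poly_Mapping.keys f.
     Poly_Mapping.single (map \<sigma> w, S) (of_int (sign \<sigma>) * Poly_Mapping.lookup f (w, S)))"

text \<open>
  The quotient \<open>V/W\<close> on the set of cosets.  The summand \<open>W\<close> in the scalar multiplication is needed
  only for the scalar 0, which would otherwise yield \<open>{0}\<close>.
\<close>

definition quot_space :: "(complex, 'v) module \<Rightarrow> 'v set \<Rightarrow> (complex, 'v set) module" where
  "quot_space V W = \<lparr>carrier = a_rcosets\<^bsub>V\<^esub> W, mult = (\<lambda>_ _. W), one = W,
     zero = W, add = set_add V, smult = (\<lambda>c X. set_add V W ((\<lambda>x. c \<odot>\<^bsub>V\<^esub> x) ` X))\<rparr>"

definition cycles :: "int set \<Rightarrow> int set \<Rightarrow> nat \<Rightarrow> (cell \<Rightarrow>\<^sub>0 complex) set" where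
  "cycles A M i = {f \<in> carrier (chain_space A M i). boundary f = 0}"

definition boundaries :: "int set \<Rightarrow> int set \<Rightarrow> nat \<Rightarrow> (cell \<Rightarrow>\<^sub>0 complex) set" where
  "boundaries A M i = boundary ` carrier (chain_space A M (Suc i))"

definition homology :: "int set \<Rightarrow> int set \<Rightarrow> nat \<Rightarrow> (complex, (cell \<Rightarrow>\<^sub>0 complex) set) module" where
  "homology A M i =
     quot_space ((chain_space A M i)\<lparr>carrier := cycles A M i\<rparr>) (boundaries A M i)"

text \<open>
  The action is equivariant for the differential, so a permutation maps the coset of \<open>z\<close> onto the
  coset of its image; as a map of cosets the induced action is the elementwise image.
\<close>

definition homology_act :: "(int \<Rightarrow> int) \<Rightarrow> (cell \<Rightarrow>\<^sub>0 complex) set \<Rightarrow> (cell \<Rightarrow>\<^sub>0 complex) set" where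
  "homology_act \<sigma> X = chain_act \<sigma> ` X"

end

theory Submission
  imports Defs "HOL-Library.List_Lexorder"
begin

text \<open>
  Equality of \<open>c_fun\<close> with the alternating sum: the character of \<open>C\<^sub>i\<close> at \<open>\<sigma>\<close> is
  \<open>sign \<sigma>\<close> times the number of injective words over the fixed points of \<open>\<sigma>\<close>, times the number
  \<open>(n - k + i) choose i\<close> of label sequences.  Splitting off the first letter of the word, which is
  a fixed point of \<open>\<sigma>\<close> and contributes a factor \<open>p\<^sub>1\<close>, reduces the Frobenius characteristic to
  \<open>\<Sum>\<sigma>. sign \<sigma> \<cdot> p\<^bsub>type \<sigma>\<^esub> = k! e\<^sub>k\<close>.  There the coefficient of a monomial counts pairs
  of \<open>\<sigma>\<close> and a \<open>\<sigma>\<close>-invariant map \<open>f\<close> with sign; for non-injective \<open>f\<close> a transposition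
  exchanging two points with equal value cancels the signs.

  Equality with the homology: the complex is exact below degree \<open>k\<close> by an acyclic matching of its
  cells, and there is nothing in degree \<open>k + 1\<close>, so \<open>H\<^sub>k\<close> is the space of \<open>k\<close>-cycles.
  Exactness gives linear projections \<open>e\<^sub>i\<close> onto the \<open>i\<close>-cycles with
  \<open>e\<^bsub>i+1\<^esub> = 1 - h \<partial>\<close> and \<open>\<partial> h = e\<^sub>i\<close>, and cyclicity of the trace yields
  \<open>tr (\<sigma> e\<^bsub>i+1\<^esub>) = tr (\<sigma> | C\<^bsub>i+1\<^esub>) - tr (\<sigma> e\<^sub>i)\<close>.
\<close>

section \<open>Linear maps between chains\<close>

text \<open>Prefixing a fixed letter does not by itself contract the complex: the letter may already
  occur, and prefixing it again would destroy injectivity. A cell that contains the letter is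
  therefore handled behind that occurrence, where the remaining letters and labels pose the same
  problem on a smaller scale.

  The homotopy \<open>h\<close> is chosen cell by cell, and nothing makes it commute with \<sigma>,
  so the complex is not split as a complex of representations. Instead a Hopf trace formula is
  proved for one \<sigma> at a time. A merely linear projection \<open>e\<close> onto a
  \<sigma>-stable subspace suffices, because the trace of \<sigma> on the subspace equals the trace
  of \<sigma> after \<open>e\<close> on the whole space; equivariance enters only through the
  boundary map. Traces on cycles thus become sums over cells, and no basis of the cycles has to be
  found.

  On the symmetric function side, dividing class sizes by k! turns the Frobenius characteristic into
  an average over all permutations. Cycle types then disappear from the calculation, and cycles can
  be handled as actual subsets of the alphabet.\<close>

abbreviation scl :: "complex \<Rightarrow> (cell \<Rightarrow>\<^sub>0 complex) \<Rightarrow> (cell \<Rightarrow>\<^sub>0 complex)" where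
  "scl c \<equiv> Poly_Mapping.map ((*) c)"

lemma lookup_scl [simp]: "Poly_Mapping.lookup (scl c f) x = c * Poly_Mapping.lookup f x"
  by (simp add: Poly_Mapping.map.rep_eq when_def)

interpretation chain: Vector_Spaces.vector_space scl
  by unfold_locales (auto intro!: poly_mapping_eqI simp: lookup_add algebra_simps)

abbreviation lin :: "((cell \<Rightarrow>\<^sub>0 complex) \<Rightarrow> (cell \<Rightarrow>\<^sub>0 complex)) \<Rightarrow> bool" where
  "lin \<equiv> Modules.module_hom scl scl"

lemma linI:
  assumes "\<And>f g. F (f + g) = F f + F g" "\<And>c f. F (scl c f) = scl c (F f)"
  shows "lin F"
  by (intro Modules.module_hom.intro Modules.module_hom_axioms.intro chain.module_axioms assms)

lemmas lin_add = Modules.module_hom.add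
  and lin_scale = Modules.module_hom.scale
  and lin_sum = Modules.module_hom.sum
  and lin_diff = Modules.module_hom.diff
  and lin_zero = Modules.module_hom.zero

lemma chain_expand:
  assumes "finite D" "Poly_Mapping.keys f \<subseteq> D"
  shows "f = (\<Sum>c\<in>D. scl (Poly_Mapping.lookup f c) (Poly_Mapping.single c 1))"
proof (rule poly_mapping_eqI)
  fix d
  have "Poly_Mapping.lookup (\<Sum>c\<in>D. scl (Poly_Mapping.lookup f c) (Poly_Mapping.single c 1)) d =
      (\<Sum>c\<in>D. if d = c then Poly_Mapping.lookup f c else 0)"
    by (auto simp: lookup_sum lookup_single when_def intro!: sum.cong)
  also have "\<dots> = Poly_Mapping.lookup f d"
    using assms by (auto simp: sum.delta' in_keys_iff)
  finally show "Poly_Mapping.lookup f d =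
      Poly_Mapping.lookup (\<Sum>c\<in>D. scl (Poly_Mapping.lookup f c) (Poly_Mapping.single c 1)) d" ..
qed

lemma lin_expand:
  assumes "lin F" "finite D" "Poly_Mapping.keys f \<subseteq> D"
  shows "F f = (\<Sum>c\<in>D. scl (Poly_Mapping.lookup f c) (F (Poly_Mapping.single c 1)))"
  by (subst chain_expand[OF assms(2,3)]) (simp only: lin_sum[OF assms(1)] lin_scale[OF assms(1)])

lemma lin_eqI:
  assumes "lin F" "lin G" "\<And>c. c \<in> D \<Longrightarrow> F (Poly_Mapping.single c 1) = G (Poly_Mapping.single c 1)"
    "Poly_Mapping.keys f \<subseteq> D"
  shows "F f = G f"
  by (subst lin_expand[OF assms(1) finite_keys order.refl], subst lin_expand[OF assms(2) finite_keys order.refl],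
      rule sum.cong[OF refl], simp only: assms(3)[OF subsetD[OF assms(4)]])

text \<open>Both \<open>boundary\<close> and \<open>chain_act\<close> sum over the keys of their
  argument, and keys may cancel when chains are added. Linearity is proved once for
  \<open>linext\<close>, by extending such sums to a common finite index set.\<close>

definition linext :: "(cell \<Rightarrow> (cell \<Rightarrow>\<^sub>0 complex)) \<Rightarrow> (cell \<Rightarrow>\<^sub>0 complex) \<Rightarrow> (cell \<Rightarrow>\<^sub>0 complex)" where
  "linext E f = (\<Sum>c\<in>Poly_Mapping.keys f. scl (Poly_Mapping.lookup f c) (E c))"

lemma linext_superset:
  assumes "finite D" "Poly_Mapping.keys f \<subseteq> D"
  shows "linext E f = (\<Sum>c\<in>D. scl (Poly_Mapping.lookup f c) (E c))"
  unfolding linext_def using assms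
  by (intro sum.mono_neutral_left) (auto simp: in_keys_iff)

lemma lin_linext: "lin (linext E)"
proof (rule linI)
  fix f g :: "cell \<Rightarrow>\<^sub>0 complex"
  let ?D = "Poly_Mapping.keys f \<union> Poly_Mapping.keys g"
  have "linext E h = (\<Sum>c\<in>?D. scl (Poly_Mapping.lookup h c) (E c))"
    if "Poly_Mapping.keys h \<subseteq> ?D" for h
    using that by (intro linext_superset) auto
  moreover have "Poly_Mapping.keys (f + g) \<subseteq> ?D"
    by (rule Poly_Mapping.keys_add)
  ultimately show "linext E (f + g) = linext E f + linext E g"
    by (simp add: lookup_add chain.scale_left_distrib sum.distrib)
next
  fix c and f :: "cell \<Rightarrow>\<^sub>0 complex"
  have "Poly_Mapping.keys (scl c f) \<subseteq> Poly_Mapping.keys f"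
    by (auto simp: in_keys_iff)
  then have "linext E (scl c f) = (\<Sum>d\<in>Poly_Mapping.keys f. scl (Poly_Mapping.lookup (scl c f) d) (E d))"
    by (intro linext_superset) auto
  then show "linext E (scl c f) = scl c (linext E f)"
    by (simp add: linext_def chain.scale_sum_right)
qed

lemma linext_single [simp]: "linext E (Poly_Mapping.single c a) = scl a (E c)"
  by (simp add: linext_superset[of "{c}"])

lemma keys_linext:
  assumes "\<And>c. c \<in> Poly_Mapping.keys f \<Longrightarrow> Poly_Mapping.keys (E c) \<subseteq> D"
  shows "Poly_Mapping.keys (linext E f) \<subseteq> D"
proof
  fix d assume "d \<in> Poly_Mapping.keys (linext E f)"
  then have "(\<Sum>c\<in>Poly_Mapping.keys f. Poly_Mapping.lookup f c * Poly_Mapping.lookup (E c) d) \<noteq> 0"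
    by (simp add: linext_def in_keys_iff lookup_sum)
  then obtain c where "c \<in> Poly_Mapping.keys f" "Poly_Mapping.lookup (E c) d \<noteq> 0"
    by (auto elim!: sum.not_neutral_contains_not_neutral)
  then have "c \<in> Poly_Mapping.keys f" "d \<in> Poly_Mapping.keys (E c)"
    by (simp_all add: in_keys_iff)
  with assms show "d \<in> D" by blast
qed

section \<open>The boundary map and the permutation action in terms of cells\<close>

definition faces :: "cell \<Rightarrow> (cell \<Rightarrow>\<^sub>0 complex)" where
  "faces c = (\<Sum>l<length (fst c).
     Poly_Mapping.single (delete_nth l (fst c), delete_nth l (snd c)) ((-1) ^ l))"

lemma boundary_linext: "boundary = linext faces"
  by (rule ext) (simp add: boundary_def linext_def faces_def chain.scale_sum_right mult.commute
      case_prod_unfold map_single)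

lemma lin_boundary: "lin boundary"
  by (simp add: boundary_linext lin_linext)

lemma chain_act_linext:
  "chain_act \<sigma> = linext (\<lambda>c. Poly_Mapping.single (map \<sigma> (fst c), snd c) (of_int (sign \<sigma>)))"
  by (rule ext) (simp add: chain_act_def linext_def case_prod_unfold map_single mult.commute)

lemma lin_chain_act: "lin (chain_act \<sigma>)"
  by (simp add: chain_act_linext lin_linext)

lemma length_delete_nth [simp]: "l < length xs \<Longrightarrow> length (delete_nth l xs) = length xs - 1"
  by (simp add: delete_nth_def)

lemma map_delete_nth: "map f (delete_nth l xs) = delete_nth l (map f xs)"
  by (simp add: delete_nth_def take_map drop_map)

lemma nth_delete_nth:
  "l < length xs \<Longrightarrow> i < length xs - 1 \<Longrightarrow> delete_nth l xs ! i = xs ! (if i < l then i else Suc i)"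
  by (auto simp: delete_nth_def nth_append min_def)

lemma delete_nth_commute:
  assumes "m < l" "l < length xs"
  shows "delete_nth m (delete_nth l xs) = delete_nth (l - 1) (delete_nth m xs)"
  using assms by (intro nth_equalityI) (auto simp: nth_delete_nth)

lemma set_delete_nth:
  assumes "distinct xs" "l < length xs"
  shows "set (delete_nth l xs) = set xs - {xs ! l}"
proof -
  have "xs = take l xs @ xs ! l # drop (Suc l) xs"
    using assms(2) by (rule id_take_nth_drop)
  then have "distinct (take l xs @ xs ! l # drop (Suc l) xs)"
    "set xs = set (take l xs @ xs ! l # drop (Suc l) xs)"
    using assms(1) by simp_all
  then show ?thesis by (auto simp: delete_nth_def)
qed

lemma delete_nth_inj:
  assumes "distinct xs" "l < length xs" "m < length xs" "delete_nth l xs = delete_nth m xs"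
  shows "l = m"
proof -
  have "set xs - {xs ! l} = set xs - {xs ! m}"
    using assms set_delete_nth by metis
  then have "xs ! l = xs ! m"
    using assms by (metis Diff_iff insert_iff nth_mem singletonD)
  then show ?thesis using assms by (simp add: nth_eq_iff_index_eq)
qed

text \<open>The map (l, m) to (m, l - 1) is a bijection from the pairs with m < l onto those whose
  first entry is at most the second, so the two halves of the sum cancel. For double deletions this
  is the simplicial identity: removing l and then m < l leaves the same list as removing m and then
  l - 1.\<close>

lemma alternating_double_sum:
  fixes F :: "nat \<Rightarrow> nat \<Rightarrow> 'a::ab_group_add"
  assumes "\<And>l m. m < l \<Longrightarrow> l < n \<Longrightarrow> F l m = - F m (l - 1)"
  shows "(\<Sum>l<n. \<Sum>m<n-1. F l m) = 0"
proof -
  let ?P = "{..<n} \<times> {..<n-1}"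
  have "(\<Sum>l<n. \<Sum>m<n-1. F l m) = (\<Sum>p\<in>?P. F (fst p) (snd p))"
    by (simp add: sum.cartesian_product case_prod_unfold)
  also have "\<dots> = (\<Sum>p\<in>?P \<inter> {p. snd p < fst p}. F (fst p) (snd p)) +
      (\<Sum>p\<in>?P \<inter> - {p. snd p < fst p}. F (fst p) (snd p))"
    by (rule sum.Int_Diff[unfolded Diff_eq]) simp
  also have "(\<Sum>p\<in>?P \<inter> {p. snd p < fst p}. F (fst p) (snd p)) =
      (\<Sum>p\<in>?P \<inter> - {p. snd p < fst p}. - F (fst p) (snd p))"
    by (rule sum.reindex_bij_witness[of _ "\<lambda>(l, m). (Suc m, l)" "\<lambda>(l, m). (m, l - 1)"])
      (auto simp: assms)
  finally show ?thesis by (simp add: sum_negf)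
qed

lemma boundary_boundary_single:
  assumes "length w = length S"
  shows "boundary (boundary (Poly_Mapping.single (w, S) 1)) = 0"
proof -
  let ?n = "length w"
  let ?d = "\<lambda>l m. (delete_nth m (delete_nth l w), delete_nth m (delete_nth l S))"
  have "boundary (boundary (Poly_Mapping.single (w, S) 1)) =
      (\<Sum>l<?n. \<Sum>m<?n-1. Poly_Mapping.single (?d l m) ((-1) ^ l * (-1) ^ m))"
    unfolding boundary_linext linext_single chain.scale_one
    by (subst faces_def)
      (simp add: lin_sum[OF lin_linext] faces_def chain.scale_sum_right map_single)
  also have "\<dots> = 0"
  proof (rule alternating_double_sum)
    fix l m assume *: "m < l" "l < ?n"
    then have "?d l m = ?d m (l - 1)"
      using assms by (simp add: delete_nth_commute)
    moreover have "(-1::complex) ^ l * (-1) ^ m = - ((-1) ^ m * (-1) ^ (l - 1))"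
      using * by (cases l) auto
    ultimately show "Poly_Mapping.single (?d l m) ((-1::complex) ^ l * (-1) ^ m) =
        - Poly_Mapping.single (?d m (l - 1)) ((-1) ^ m * (-1) ^ (l - 1))"
      by (simp add: single_uminus)
  qed
  finally show ?thesis .
qed

lemma boundary_boundary:
  assumes "Poly_Mapping.keys f \<subseteq> Delta A M i"
  shows "boundary (boundary f) = 0"
proof -
  have "boundary f = (\<Sum>c\<in>Poly_Mapping.keys f. scl (Poly_Mapping.lookup f c) (boundary (Poly_Mapping.single c 1)))"
    by (intro lin_expand lin_boundary) auto
  then have "boundary (boundary f) = (\<Sum>c\<in>Poly_Mapping.keys f. scl (Poly_Mapping.lookup f c)
      (boundary (boundary (Poly_Mapping.single c 1))))"
    by (simp add: lin_sum[OF lin_boundary] lin_scale[OF lin_boundary])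
  also have "\<dots> = 0"
  proof (rule sum.neutral, rule ballI)
    fix c assume "c \<in> Poly_Mapping.keys f"
    then have "length (fst c) = length (snd c)"
      using assms by (force simp: Delta_def)
    then show "scl (Poly_Mapping.lookup f c) (boundary (boundary (Poly_Mapping.single c 1))) = 0"
      using boundary_boundary_single[of "fst c" "snd c"] by simp
  qed
  finally show ?thesis .
qed

lemma sorted_delete_nth:
  assumes "sorted xs"
  shows "sorted (delete_nth l xs)"
proof -
  have "sorted (take l xs @ drop l xs)"
    using assms by simp
  moreover have "set (drop (Suc l) xs) \<subseteq> set (drop l xs)"
    by (rule set_drop_subset_set_drop) simp
  ultimately show ?thesis
    unfolding delete_nth_def sorted_append using assms by (auto simp: sorted_wrt_drop)
qed

lemma distinct_delete_nth: "distinct xs \<Longrightarrow> distinct (delete_nth l xs)"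
  unfolding delete_nth_def
  by (simp add: set_take_disj_set_drop_if_distinct)

lemma set_delete_nth_subset: "set (delete_nth l xs) \<subseteq> set xs"
  unfolding delete_nth_def by (auto dest: in_set_takeD in_set_dropD)

lemma delete_nth_Delta:
  assumes "c \<in> Delta A M (Suc i)" "l < length (fst c)"
  shows "(delete_nth l (fst c), delete_nth l (snd c)) \<in> Delta A M i"
  using assms order_trans[OF set_delete_nth_subset[of l "fst c"], of A]
    order_trans[OF set_delete_nth_subset[of l "snd c"], of M]
  by (simp add: Delta_def case_prod_unfold sorted_delete_nth distinct_delete_nth)

lemma keys_faces:
  assumes "c \<in> Delta A M (Suc i)"
  shows "Poly_Mapping.keys (faces c) \<subseteq> Delta A M i"
proof -
  have "Poly_Mapping.keys (faces c) \<subseteq> (\<Union>l<length (fst c). Poly_Mapping.keys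
      (Poly_Mapping.single (delete_nth l (fst c), delete_nth l (snd c)) ((-1::complex) ^ l)))"
    unfolding faces_def by (rule keys_sum)
  also have "\<dots> \<subseteq> Delta A M i"
    using delete_nth_Delta[OF assms] by auto
  finally show ?thesis .
qed

lemma keys_boundary:
  assumes "Poly_Mapping.keys f \<subseteq> Delta A M (Suc i)"
  shows "Poly_Mapping.keys (boundary f) \<subseteq> Delta A M i"
  unfolding boundary_linext using assms keys_faces by (intro keys_linext) blast

lemma boundary_Delta_0:
  assumes "Poly_Mapping.keys f \<subseteq> Delta A M 0"
  shows "boundary f = 0"
  unfolding boundary_linext linext_def
  using assms by (intro sum.neutral) (auto simp: Delta_def faces_def)

lemma finite_Delta:
  assumes "finite A" "finite M"
  shows "finite (Delta A M i)"
  by (rule finite_subset[of _ "{w. set w \<subseteq> A \<and> length w = i} \<times> {S. set S \<subseteq> M \<and> length S = i}"])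
    (auto simp: Delta_def finite_lists_length_eq assms)

lemma permutes_Delta:
  assumes "\<sigma> permutes A" "(w, S) \<in> Delta A M i"
  shows "(map \<sigma> w, S) \<in> Delta A M i"
  using assms(2) permutes_in_image[OF assms(1)] inj_on_subset[OF permutes_inj[OF assms(1)], of "set w"]
  by (auto simp: Delta_def distinct_map)

lemma keys_chain_act:
  assumes "\<sigma> permutes A" "Poly_Mapping.keys f \<subseteq> Delta A M i"
  shows "Poly_Mapping.keys (chain_act \<sigma> f) \<subseteq> Delta A M i"
  unfolding chain_act_linext
proof (rule keys_linext)
  fix c assume "c \<in> Poly_Mapping.keys f"
  then have "(map \<sigma> (fst c), snd c) \<in> Delta A M i"
    using assms(2) permutes_Delta[OF assms(1), of "fst c" "snd c"] by auto
  then show "Poly_Mapping.keys (Poly_Mapping.single (map \<sigma> (fst c), snd c)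
      (complex_of_int (sign \<sigma>))) \<subseteq> Delta A M i"
    by simp
qed

lemma boundary_chain_act: "boundary (chain_act \<sigma> f) = chain_act \<sigma> (boundary f)"
proof -
  have l: "lin (boundary \<circ> chain_act \<sigma>)" "lin (chain_act \<sigma> \<circ> boundary)"
    by (auto intro!: linI simp: lin_add[OF lin_boundary] lin_add[OF lin_chain_act]
        lin_scale[OF lin_boundary] lin_scale[OF lin_chain_act])
  have "(boundary \<circ> chain_act \<sigma>) f = (chain_act \<sigma> \<circ> boundary) f"
  proof (rule lin_eqI[OF l _ subset_UNIV])
    fix c
    show "(boundary \<circ> chain_act \<sigma>) (Poly_Mapping.single c 1) =
        (chain_act \<sigma> \<circ> boundary) (Poly_Mapping.single c 1)"
      by (simp add: boundary_linext chain_act_linext faces_def lin_sum[OF lin_linext]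
          chain.scale_sum_right map_delete_nth map_single mult.commute)
  qed
  then show ?thesis by simp
qed

section \<open>Exactness below the top degree\<close>

text \<open>
  \<open>match A j l u \<pi>\<close> pairs a cell \<open>l\<close> with a cell \<open>u\<close> that has one letter more, where \<open>A\<close> is the
  alphabet and \<open>j\<close> the smallest label still available.  If \<open>Min A\<close> does not occur, it is inserted in
  front with label \<open>j\<close>; otherwise the matching recurses to the part after \<open>Min A\<close>, with the letters
  up to \<open>Min A\<close> removed from the alphabet.  The list \<open>\<pi>\<close> of the lengths of the skipped pieces
  is the rank, compared lexicographically, that makes the matching acyclic (\<open>match_delete\<close>).
\<close>

inductive match :: "int set \<Rightarrow> int \<Rightarrow> (int \<times> int) list \<Rightarrow> (int \<times> int) list \<Rightarrow> nat list \<Rightarrow> bool" where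
  base: "Min A \<in> A \<Longrightarrow> Min A \<notin> fst ` set y \<Longrightarrow> match A j y ((Min A, j) # y) []"
| step: "Min A \<in> A \<Longrightarrow> Min A \<notin> fst ` set x \<Longrightarrow> (x, j) \<noteq> ([], j0) \<Longrightarrow>
    match (A - insert (Min A) (fst ` set x)) j l u \<pi> \<Longrightarrow>
    match A j0 (x @ (Min A, j) # l) (x @ (Min A, j) # u) (length x # \<pi>)"

lemma split_at_first:
  "a \<notin> fst ` set x \<Longrightarrow> a \<notin> fst ` set x' \<Longrightarrow> x @ (a, j) # r = x' @ (a, j') # r' \<Longrightarrow>
    x = x' \<and> j = j' \<and> r = r'"
proof (induction x arbitrary: x')
  case Nil
  then show ?case by (cases x') auto
next
  case (Cons p x)
  then show ?case by (cases x') auto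
qed

lemma match_step_inv:
  assumes "match A j0 (x @ (Min A, j) # r) u \<pi>" "Min A \<notin> fst ` set x"
  shows "(x, j) \<noteq> ([], j0) \<and> (\<exists>u1 \<pi>1. match (A - insert (Min A) (fst ` set x)) j r u1 \<pi>1 \<and>
    u = x @ (Min A, j) # u1 \<and> \<pi> = length x # \<pi>1)"
  using assms(1)
proof cases
  case base
  then show ?thesis by simp
next
  case (step x' j' l u' \<pi>')
  then have "x = x' \<and> j = j' \<and> r = l"
    using split_at_first[of "Min A" x x' j r j' l] assms(2) by simp
  with step show ?thesis by blast
qed

lemma match_base_inv:
  assumes "match A j0 l u \<pi>" "Min A \<notin> fst ` set l"
  shows "u = (Min A, j0) # l \<and> \<pi> = []"
  using assms by cases auto

lemma match_functional:
  "match A j0 l u \<pi> \<Longrightarrow> match A j0 l u' \<pi>' \<Longrightarrow> u = u' \<and> \<pi> = \<pi>'"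
proof (induction arbitrary: u' \<pi>' rule: match.induct)
  case (base A y j)
  then show ?case using match_base_inv by metis
next
  case (step A x j j0 l u \<pi>)
  then show ?case using match_step_inv[OF step.prems] by blast
qed

text \<open>A face of an upper cell that is itself a lower cell is either the partner or has smaller
  rank. Deleting from the skipped piece \<open>x\<close> lowers the first entry of the rank;
  deleting \<open>Min A\<close> makes the rank \<open>[]\<close>, which is smallest; deleting
  further right leaves the first entry and is covered by induction. In the base case a face other
  than the partner still starts with \<open>(Min A, j)\<close> at the smallest label, and such a
  list is never lower.\<close>

lemma match_delete:
  "match A j0 l u \<pi> \<Longrightarrow> distinct (map fst u) \<Longrightarrow> t < length u \<Longrightarrow>
    match A j0 (delete_nth t u) u' \<pi>' \<Longrightarrow> delete_nth t u = l \<or> \<pi>' < \<pi>"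
proof (induction arbitrary: t u' \<pi>' rule: match.induct)
  case (base A y j)
  show ?case
  proof (cases t)
    case 0
    then show ?thesis by (simp add: delete_nth_def)
  next
    case (Suc s)
    then have "match A j ([] @ (Min A, j) # delete_nth s y) u' \<pi>'"
      using base.prems(3) by (simp add: delete_nth_def)
    from match_step_inv[OF this] show ?thesis by simp
  qed
next
  case (step A x j j0 l u \<pi>)
  consider "t < length x" | "t = length x" | s where "t = Suc (length x + s)" "s < length u"
    using step.prems(2) less_imp_Suc_add[of "length x" t] by fastforce
  then show ?case
  proof cases
    case 1
    let ?x = "delete_nth t x"
    have "delete_nth t (x @ (Min A, j) # u) = ?x @ (Min A, j) # u"
      using 1 by (simp add: delete_nth_def)
    moreover have "Min A \<notin> fst ` set ?x"
      using step.hyps(2) set_delete_nth_subset[of t x] by blast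
    ultimately obtain \<pi>1 where "\<pi>' = length ?x # \<pi>1"
      using match_step_inv step.prems(3) by metis
    moreover have "length ?x < length x" using 1 by (subst length_delete_nth) linarith+
    ultimately show ?thesis by simp
  next
    case 2
    then have "delete_nth t (x @ (Min A, j) # u) = x @ u"
      by (simp add: delete_nth_def)
    moreover have "Min A \<notin> fst ` set (x @ u)"
      using step.prems(1) by auto
    ultimately have "\<pi>' = []"
      using match_base_inv step.prems(3) by metis
    then show ?thesis by simp
  next
    case 3
    then have d: "delete_nth t (x @ (Min A, j) # u) = x @ (Min A, j) # delete_nth s u"
      by (simp add: delete_nth_def)
    then obtain u1 \<pi>1 where
      "match (A - insert (Min A) (fst ` set x)) j (delete_nth s u) u1 \<pi>1" "\<pi>' = length x # \<pi>1"
      using match_step_inv[of A j0 x j "delete_nth s u" u' \<pi>'] step.prems(3) step.hyps(2) by auto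
    then show ?thesis
      using step.IH[of s u1 \<pi>1] step.prems(1) 3 d by auto
  qed
qed

text \<open>Each descent removes \<open>Min A\<close> and the letters of \<open>x\<close> from the
  alphabet and equally many entries from the list. Hence \<open>length ps < card A\<close> is
  preserved, the alphabet never runs out, and \<open>Min\<close> is always taken of a nonempty set.
  This is where exactness stops below the top degree.\<close>

lemma match_exists:
  "finite A \<Longrightarrow> distinct (map fst ps) \<Longrightarrow> fst ` set ps \<subseteq> A \<Longrightarrow> length ps < card A \<Longrightarrow>
    \<exists>l u \<pi>. match A j0 l u \<pi> \<and> (ps = l \<or> ps = u)"
proof (induction "length ps" arbitrary: A j0 ps rule: less_induct)
  case less
  have a: "Min A \<in> A"
    using less.prems by (intro Min_in) auto
  show ?case
  proof (cases "Min A \<in> fst ` set ps")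
    case False
    then show ?thesis using match.base[OF a, of ps j0] by blast
  next
    case True
    then obtain w1 w2 where w: "map fst ps = w1 @ Min A # w2" "Min A \<notin> set w1"
      using split_list_first[of "Min A" "map fst ps"] by auto
    then obtain x r' where xr: "ps = x @ r'" "map fst x = w1" "map fst r' = Min A # w2"
      by (auto simp: map_eq_append_conv)
    then obtain j r where r: "r' = (Min A, j) # r"
      by auto
    have ps: "ps = x @ (Min A, j) # r" using xr r by simp
    have x: "Min A \<notin> fst ` set x" using w(2) unfolding xr(2)[symmetric] by simp
    show ?thesis
    proof (cases "(x, j) = ([], j0)")
      \<comment> \<open>\<open>Min A\<close> in front with the smallest label makes
        \<open>ps\<close> an upper cell. The rule \<open>step\<close> excludes precisely this
        configuration, so that it is not also treated as a cell to be matched further right.\<close>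
      case True
      moreover have "Min A \<notin> fst ` set r"
        using less.prems(2) ps by simp
      ultimately show ?thesis using match.base[OF a, of r j0] ps by auto
    next
      case False
      let ?A = "A - insert (Min A) (fst ` set x)"
      have "card (insert (Min A) (fst ` set x)) = Suc (length x)"
        using x less.prems(2) ps by (simp add: card_image distinct_map distinct_card)
      then have "card ?A = card A - Suc (length x)"
        using less.prems a ps by (subst card_Diff_subset) auto
      then have "length r < card ?A"
        using less.prems ps by auto
      moreover have "distinct (map fst r)" "fst ` set r \<subseteq> ?A"
        using less.prems ps by (auto intro: rev_image_eqI)
      ultimately obtain l u \<pi> where m: "match ?A j l u \<pi>" and "r = l \<or> r = u"
        using less.hyps[of r ?A j] less.prems(1) ps by auto
      with match.step[OF a x False m] ps show ?thesis by blast
    qed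
  qed
qed

section \<open>Matched lists as cells of the complex\<close>

definition labelled_words :: "int set \<Rightarrow> int set \<Rightarrow> nat \<Rightarrow> (int \<times> int) list set" where
  "labelled_words A M i = {ps. length ps = i \<and> distinct (map fst ps) \<and> fst ` set ps \<subseteq> A \<and>
    sorted (map snd ps) \<and> snd ` set ps \<subseteq> M}"

text \<open>Letters and labels are kept as one list of pairs wherever the matching is involved, so
  that a cut or a deletion acts on both sequences at once.\<close>

definition pcell :: "(int \<times> int) list \<Rightarrow> cell" where
  "pcell ps = (map fst ps, map snd ps)"

lemma inj_pcell: "inj pcell"
  by (rule injI) (metis pcell_def prod.inject zip_map_fst_snd)

lemma pcell_eq_iff [simp]: "pcell p = pcell q \<longleftrightarrow> p = q"
  using inj_pcell by (auto dest: injD)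

lemma Delta_eq: "Delta A M i = pcell ` labelled_words A M i"
proof
  show "pcell ` labelled_words A M i \<subseteq> Delta A M i"
    by (auto simp: pcell_def labelled_words_def Delta_def)
  show "Delta A M i \<subseteq> pcell ` labelled_words A M i"
  proof
    fix c assume "c \<in> Delta A M i"
    then have c: "length (fst c) = i" "distinct (fst c)" "set (fst c) \<subseteq> A" "length (snd c) = i"
      "sorted (snd c)" "set (snd c) \<subseteq> M"
      by (auto simp: Delta_def)
    have m: "map fst (zip (fst c) (snd c)) = fst c" "map snd (zip (fst c) (snd c)) = snd c"
      using c by simp_all
    then have "c = pcell (zip (fst c) (snd c))"
      by (simp add: pcell_def)
    moreover have "zip (fst c) (snd c) \<in> labelled_words A M i"
      unfolding labelled_words_def mem_Collect_eq m using c m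
      by (auto dest: set_zip_leftD set_zip_rightD)
    ultimately show "c \<in> pcell ` labelled_words A M i" by blast
  qed
qed

text \<open>The inserted pair carries the smallest label still allowed at its place:
  \<open>j0\<close> in front, or the label of the last \<open>Min A\<close> passed, which bounds all
  labels behind it. So the labels stay sorted, and no label other than \<open>j0\<close> is new. The
  inserted letter comes from the remaining alphabet, which keeps the word injective.\<close>

lemma match_upper_props:
  "match A j0 l u \<pi> \<Longrightarrow> distinct (map fst l) \<Longrightarrow> fst ` set l \<subseteq> A \<Longrightarrow> sorted (map snd l) \<Longrightarrow>
    \<forall>p\<in>set l. j0 \<le> snd p \<Longrightarrow>
    distinct (map fst u) \<and> fst ` set u \<subseteq> A \<and> sorted (map snd u) \<and>
    snd ` set u \<subseteq> insert j0 (snd ` set l)"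
proof (induction rule: match.induct)
  case (base A y j)
  then show ?case by auto
next
  case (step A x j j0 l u \<pi>)
  have IH: "distinct (map fst u) \<and> fst ` set u \<subseteq> A - insert (Min A) (fst ` set x) \<and>
      sorted (map snd u) \<and> snd ` set u \<subseteq> insert j (snd ` set l)"
    using step.prems by (intro step.IH) (auto simp: sorted_append intro: rev_image_eqI)
  have x: "distinct (map fst x)" "fst ` set x \<subseteq> A" "sorted (map snd x)"
    "\<forall>p\<in>set x. snd p \<le> j" "\<forall>p\<in>set l. j \<le> snd p"
    using step.prems by (auto simp: sorted_append)
  have u: "\<forall>q\<in>set u. j \<le> snd q"
  proof
    fix q assume "q \<in> set u"
    then have "snd q \<in> insert j (snd ` set l)" using IH by blast
    then show "j \<le> snd q" using x(5) by auto
  qed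
  have xu: "\<forall>p\<in>set x. \<forall>q\<in>set u. snd p \<le> snd q"
    using x(4) u order_trans by blast
  have "distinct (map fst (x @ (Min A, j) # u))"
    using IH x(1) step.hyps(2) by auto
  moreover have "fst ` set (x @ (Min A, j) # u) \<subseteq> A"
    using IH x(2) step.hyps(1) by auto
  moreover have "sorted (map snd (x @ (Min A, j) # u))"
    using IH x(3,4) u xu by (simp add: sorted_append)
  moreover have "snd ` set (x @ (Min A, j) # u) \<subseteq> insert j0 (snd ` set (x @ (Min A, j) # l))"
    using IH by auto
  ultimately show ?case by blast
qed

lemma match_delete_exists:
  "match A j0 l u \<pi> \<Longrightarrow> \<exists>t<length u. delete_nth t u = l"
proof (induction rule: match.induct)
  case (base A y j)
  then show ?case by (intro exI[of _ 0]) (simp add: delete_nth_def)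
next
  case (step A x j j0 l u \<pi>)
  then obtain t where "t < length u" "delete_nth t u = l" by blast
  then show ?case
    by (intro exI[of _ "Suc (length x + t)"]) (simp add: delete_nth_def)
qed

lemma match_upper_in:
  assumes "match A j0 l u \<pi>" "l \<in> labelled_words A M i" "j0 \<in> M" "\<forall>m\<in>M. j0 \<le> m"
  shows "u \<in> labelled_words A M (Suc i)"
proof -
  obtain t where "t < length u" "delete_nth t u = l"
    using match_delete_exists[OF assms(1)] by blast
  then have "length u = Suc (length l)" by auto
  moreover have "distinct (map fst u) \<and> fst ` set u \<subseteq> A \<and> sorted (map snd u) \<and>
    snd ` set u \<subseteq> insert j0 (snd ` set l)"
    using assms by (intro match_upper_props) (auto simp: labelled_words_def)
  moreover have "insert j0 (snd ` set l) \<subseteq> M" "length l = i"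
    using assms(2,3) by (auto simp: labelled_words_def)
  ultimately show ?thesis
    unfolding labelled_words_def by blast
qed

text \<open>With distinct letters the faces of a cell are pairwise distinct, so no terms of its
  boundary merge and every incidence coefficient is a sign. In particular it can be divided
  by.\<close>

lemma lookup_faces_pcell:
  assumes "distinct (map fst u)" "t < length u"
  shows "Poly_Mapping.lookup (faces (pcell u)) (pcell (delete_nth t u)) = (-1) ^ t"
proof -
  have d: "distinct u" using assms(1) by (simp add: distinct_map)
  have "Poly_Mapping.lookup (faces (pcell u)) (pcell (delete_nth t u)) =
      (\<Sum>l<length u. if l = t then (-1) ^ l else 0)"
    unfolding faces_def lookup_sum
  proof (rule sum.cong)
    fix l assume "l \<in> {..<length u}"
    then have "pcell (delete_nth l u) = pcell (delete_nth t u) \<longleftrightarrow> l = t"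
      using delete_nth_inj[OF d _ assms(2)] by auto
    then show "Poly_Mapping.lookup (Poly_Mapping.single
        (delete_nth l (fst (pcell u)), delete_nth l (snd (pcell u))) ((-1::complex) ^ l))
        (pcell (delete_nth t u)) = (if l = t then (-1) ^ l else 0)"
      by (simp add: pcell_def map_delete_nth lookup_single when_def)
  qed (simp add: pcell_def)
  also have "\<dots> = (-1) ^ t" using assms(2) by simp
  finally show ?thesis .
qed

lemma lookup_faces_nonzero:
  assumes "Poly_Mapping.lookup (faces (pcell u)) (pcell l) \<noteq> 0"
  shows "\<exists>t<length u. l = delete_nth t u"
proof -
  obtain t where t: "t < length u"
    "Poly_Mapping.lookup (Poly_Mapping.single (pcell (delete_nth t u)) ((-1::complex) ^ t)) (pcell l) \<noteq> 0"
    using assms unfolding faces_def lookup_sum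
    by (auto elim!: sum.not_neutral_contains_not_neutral simp: pcell_def map_delete_nth)
  then show ?thesis by (auto simp: lookup_single when_def split: if_splits)
qed

lemma lookup_boundary:
  "Poly_Mapping.lookup (boundary f) d =
    (\<Sum>c\<in>Poly_Mapping.keys f. Poly_Mapping.lookup f c * Poly_Mapping.lookup (faces c) d)"
  by (simp add: boundary_linext linext_def lookup_sum)

text \<open>Every cell in the support is upper. Take one of maximal rank, with partner
  \<open>l\<close>. By \<open>match_delete\<close> any other cell of the support with face
  \<open>l\<close> would have larger rank, so the coefficient of \<open>l\<close> in the boundary
  is, up to sign, that of the chosen cell and cannot vanish.\<close>

lemma cycle_without_lower_cells:
  assumes A: "finite A" and i: "i < card A"
    and z: "Poly_Mapping.keys z \<subseteq> Delta A M i" "boundary z = 0"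
    and no_lower: "\<And>l u \<pi>. match A j0 l u \<pi> \<Longrightarrow> pcell l \<notin> Poly_Mapping.keys z"
  shows "z = 0"
proof (rule ccontr)
  assume "z \<noteq> 0"
  define T where "T = {(\<pi>, l). \<exists>u. match A j0 l u \<pi> \<and> pcell u \<in> Poly_Mapping.keys z}"
  have upper: "\<exists>l \<pi> u. c = pcell u \<and> match A j0 l u \<pi> \<and> distinct (map fst u)"
    if c: "c \<in> Poly_Mapping.keys z" for c
  proof -
    obtain ps where ps: "c = pcell ps" "ps \<in> labelled_words A M i"
      using z(1) c by (auto simp: Delta_eq)
    then show ?thesis
      using match_exists[OF A, of ps j0] i no_lower c by (auto simp: labelled_words_def)
  qed
  have finT: "finite (fst ` T)"
  proof -
    \<comment> \<open>The lower cell determines the rank and is a face of a cell in the finite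
      support, so the pairs of such a cell and a deleted position parametrise all ranks.\<close>
    have "fst ` T \<subseteq> (\<lambda>(u, t). THE \<pi>. \<exists>u'. match A j0 (delete_nth t u) u' \<pi>) `
        (SIGMA u:{u. pcell u \<in> Poly_Mapping.keys z}. {..<length u})"
    proof
      fix \<pi> assume "\<pi> \<in> fst ` T"
      then obtain l u where m: "match A j0 l u \<pi>" "pcell u \<in> Poly_Mapping.keys z"
        by (auto simp: T_def)
      obtain t where t: "t < length u" "delete_nth t u = l"
        using match_delete_exists[OF m(1)] by blast
      have "(THE \<pi>. \<exists>u'. match A j0 (delete_nth t u) u' \<pi>) = \<pi>"
        using m(1) t match_functional by (intro the_equality) blast+
      then show "\<pi> \<in> (\<lambda>(u, t). THE \<pi>. \<exists>u'. match A j0 (delete_nth t u) u' \<pi>) `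
          (SIGMA u:{u. pcell u \<in> Poly_Mapping.keys z}. {..<length u})"
        using m t by (intro image_eqI[of _ _ "(u, t)"]) auto
    qed
    moreover have "finite {u. pcell u \<in> Poly_Mapping.keys z}"
      using finite_vimageI[OF finite_keys[of z] inj_pcell] by (simp add: vimage_def)
    ultimately show ?thesis
      by (rule finite_subset[OF _ finite_imageI[OF finite_SigmaI]]) simp
  qed
  have "T \<noteq> {}"
  proof -
    obtain c where "c \<in> Poly_Mapping.keys z" using \<open>z \<noteq> 0\<close> by (metis ex_in_conv keys_eq_empty)
    with upper[OF this] show ?thesis by (auto simp: T_def)
  qed
  then have "Max (fst ` T) \<in> fst ` T" using finT by (intro Max_in) auto
  then obtain l u \<pi> where m: "match A j0 l u \<pi>" "pcell u \<in> Poly_Mapping.keys z"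
    and max: "\<pi> = Max (fst ` T)"
    by (auto simp: T_def)
  have other: "Poly_Mapping.lookup (faces c) (pcell l) = 0"
    if c: "c \<in> Poly_Mapping.keys z" "c \<noteq> pcell u" for c
  proof (rule ccontr)
    assume nz: "Poly_Mapping.lookup (faces c) (pcell l) \<noteq> 0"
    obtain l' \<pi>' u' where u': "c = pcell u'" "match A j0 l' u' \<pi>'" "distinct (map fst u')"
      using upper[OF c(1)] by blast
    obtain t where t: "t < length u'" "l = delete_nth t u'"
      using lookup_faces_nonzero nz u'(1) by blast
    have "l = l' \<or> \<pi> < \<pi>'"
      using match_delete[OF u'(2,3) t(1)] m(1) t(2) by blast
    moreover have "l \<noteq> l'"
      using match_functional[OF m(1)] u' c(2) by blast
    moreover have "\<pi>' \<le> \<pi>"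
      unfolding max using u' c(1) by (intro Max_ge finT) (force simp: T_def)
    ultimately show False by simp
  qed
  obtain t where t: "t < length u" "delete_nth t u = l"
    using match_delete_exists[OF m(1)] by blast
  have du: "distinct (map fst u)"
    using upper[OF m(2)] by auto
  have "Poly_Mapping.lookup (boundary z) (pcell l) =
      (\<Sum>c\<in>Poly_Mapping.keys z. if c = pcell u then Poly_Mapping.lookup z c * (-1) ^ t else 0)"
    unfolding lookup_boundary
    using other lookup_faces_pcell[OF du t(1)] t(2) by (intro sum.cong) auto
  also have "\<dots> = Poly_Mapping.lookup z (pcell u) * (-1) ^ t"
    using m(2) by (simp add: sum.delta)
  finally show False
    using z(2) m(2) by (simp add: in_keys_iff)
qed

text \<open>Gaussian elimination along the matching: boundaries of upper cells are subtracted to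
  clear the lower cells from \<open>z\<close>, highest rank first. The boundary of an upper cell
  contains its partner with invertible coefficient and otherwise only lower cells of smaller rank.
  What remains is a cycle without lower cells, hence 0.\<close>

theorem exact_below_top:
  assumes A: "finite A" and M: "finite M" "M \<noteq> {}" and i: "i < card A"
    and z: "Poly_Mapping.keys z \<subseteq> Delta A M i" "boundary z = 0"
  shows "\<exists>y. Poly_Mapping.keys y \<subseteq> Delta A M (Suc i) \<and> boundary y = z"
proof -
  define j0 where "j0 = Min M"
  have j0: "j0 \<in> M" "\<forall>m\<in>M. j0 \<le> m" using M by (auto simp: j0_def)
  define L where "L = {l \<in> labelled_words A M i. \<exists>u \<pi>. match A j0 l u \<pi>}"
  have "\<forall>l\<in>L. \<exists>q. match A j0 l (fst q) (snd q)"
    by (auto simp: L_def)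
  from bchoice[OF this] obtain q where q: "\<forall>l\<in>L. match A j0 l (fst (q l)) (snd (q l))" ..
  define U P where "U l = fst (q l)" and "P l = snd (q l)" for l
  have UP: "match A j0 l (U l) (P l)" if "l \<in> L" for l
    using q that by (simp add: U_def P_def)
  have U_in: "U l \<in> labelled_words A M (Suc i)" if "l \<in> L" for l
    using match_upper_in[OF UP[OF that] _ j0] that by (auto simp: L_def)
  have finL: "finite L"
  proof -
    have "finite (pcell ` labelled_words A M i)"
      using finite_Delta[OF A M(1)] by (simp add: Delta_eq)
    then have "finite (labelled_words A M i)"
      by (rule finite_imageD) (simp add: inj_on_def)
    then show ?thesis by (simp add: L_def)
  qed
  define b where "b l = Poly_Mapping.lookup (faces (pcell (U l))) (pcell l)" for l
  have b_nz: "b l \<noteq> 0" if l: "l \<in> L" for l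
  proof -
    obtain t where t: "t < length (U l)" "delete_nth t (U l) = l"
      using match_delete_exists[OF UP[OF l]] by blast
    have "b l = (-1) ^ t"
      unfolding b_def using lookup_faces_pcell[OF _ t(1)] t(2) U_in[OF l]
      by (simp add: labelled_words_def)
    then show ?thesis by simp
  qed
  \<comment> \<open>The lexicographic order on lists is not well-founded. Counting the members of
    the finite set \<open>L\<close> of smaller rank replaces it by a natural number on which to
    induct.\<close>
  define rk where "rk l = card {l' \<in> L. P l' < P l}" for l
  have rk_less: "rk l < rk l'"
    if l: "l \<in> L" "l' \<in> L" "l \<noteq> l'"
      "Poly_Mapping.lookup (faces (pcell (U l'))) (pcell l) \<noteq> 0" for l l'
  proof -
    obtain t where t: "t < length (U l')" "l = delete_nth t (U l')"
      using lookup_faces_nonzero l(4) by blast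
    have "P l < P l'"
      using match_delete[OF UP[OF l(2)] _ t(1)] UP[OF l(1)] t(2) U_in[OF l(2)] l(3)
      by (auto simp: labelled_words_def)
    then show ?thesis
      unfolding rk_def using l finL by (intro psubset_card_mono) auto
  qed
  have "\<exists>y. Poly_Mapping.keys y \<subseteq> Delta A M (Suc i) \<and> boundary y = z"
    if "Poly_Mapping.keys z \<subseteq> Delta A M i" "boundary z = 0"
      "\<And>l. l \<in> L \<Longrightarrow> pcell l \<in> Poly_Mapping.keys z \<Longrightarrow> rk l < n" for n z
    using that
  proof (induction n arbitrary: z)
    case 0
    have "pcell l \<notin> Poly_Mapping.keys z" if m: "match A j0 l u \<pi>" for l u \<pi>
    proof
      assume k: "pcell l \<in> Poly_Mapping.keys z"
      then have "l \<in> labelled_words A M i"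
        using 0(1) by (auto simp: Delta_eq)
      with m have "l \<in> L" by (auto simp: L_def)
      from 0(3)[OF this k] show False by simp
    qed
    then have "z = 0"
      using cycle_without_lower_cells[OF A i 0(1,2)] by blast
    then show ?case by (intro exI[of _ 0]) (simp add: lin_zero[OF lin_boundary])
  next
    case (Suc n)
    define N where "N = {l \<in> L. rk l = n}"
    \<comment> \<open>Dividing by the incidence coefficient \<open>b l\<close> makes the boundary of
      \<open>y\<close> agree with \<open>z\<close> at every lower cell of rank exactly n, all of
      which are cleared at once; lower cells of larger rank are untouched.\<close>
    define y where "y = (\<Sum>l\<in>N. Poly_Mapping.single (pcell (U l)) (Poly_Mapping.lookup z (pcell l) / b l))"
    have N: "N \<subseteq> L" "finite N" using finL by (auto simp: N_def)
    have y: "Poly_Mapping.keys y \<subseteq> Delta A M (Suc i)"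
    proof -
      have "Poly_Mapping.keys y \<subseteq> (\<Union>l\<in>N. Poly_Mapping.keys
          (Poly_Mapping.single (pcell (U l)) (Poly_Mapping.lookup z (pcell l) / b l)))"
        unfolding y_def by (rule keys_sum)
      also have "\<dots> \<subseteq> Delta A M (Suc i)"
        using N U_in by (auto simp: Delta_eq)
      finally show ?thesis .
    qed
    have by_eq: "Poly_Mapping.lookup (boundary y) d =
        (\<Sum>l\<in>N. Poly_Mapping.lookup z (pcell l) / b l * Poly_Mapping.lookup (faces (pcell (U l))) d)" for d
      by (simp add: y_def boundary_linext lin_sum[OF lin_linext] lookup_sum)
    have "\<exists>x. Poly_Mapping.keys x \<subseteq> Delta A M (Suc i) \<and> boundary x = z - boundary y"
    proof (rule Suc.IH)
      show "Poly_Mapping.keys (z - boundary y) \<subseteq> Delta A M i"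
        using keys_boundary[OF y] Suc.prems(1) keys_diff[of z "boundary y"] by blast
      show "boundary (z - boundary y) = 0"
        using Suc.prems(2) boundary_boundary[OF y] by (simp add: lin_diff[OF lin_boundary])
      fix l assume l: "l \<in> L" and key: "pcell l \<in> Poly_Mapping.keys (z - boundary y)"
      show "rk l < n"
      proof (rule ccontr)
        assume ge: "\<not> rk l < n"
        have "Poly_Mapping.lookup (boundary y) (pcell l) =
            (\<Sum>l'\<in>N. if l' = l then Poly_Mapping.lookup z (pcell l) else 0)"
          unfolding by_eq
        proof (rule sum.cong[OF refl])
          fix l' assume l': "l' \<in> N"
          show "Poly_Mapping.lookup z (pcell l') / b l' * Poly_Mapping.lookup (faces (pcell (U l'))) (pcell l) =
              (if l' = l then Poly_Mapping.lookup z (pcell l) else 0)"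
          proof (cases "l' = l")
            case True
            then show ?thesis using b_nz[OF l] by (simp add: b_def[symmetric])
          next
            case False
            then have "Poly_Mapping.lookup (faces (pcell (U l'))) (pcell l) = 0"
              using rk_less[OF l, of l'] l' ge by (auto simp: N_def)
            then show ?thesis using False by simp
          qed
        qed
        also have "\<dots> = (if l \<in> N then Poly_Mapping.lookup z (pcell l) else 0)"
          using N by (simp add: sum.delta)
        also have "\<dots> = Poly_Mapping.lookup z (pcell l)"
        proof (cases "l \<in> N")
          case False
          then have "n < rk l" using ge l by (auto simp: N_def)
          then have "pcell l \<notin> Poly_Mapping.keys z" using Suc.prems(3)[OF l] by auto
          then show ?thesis by (simp add: in_keys_iff)
        qed simp
        finally show False using key by (simp add: in_keys_iff lookup_minus)
      qed
    qed
    then obtain x where x: "Poly_Mapping.keys x \<subseteq> Delta A M (Suc i)" "boundary x = z - boundary y"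
      by blast
    have "Poly_Mapping.keys (x + y) \<subseteq> Delta A M (Suc i)"
      using x(1) y Poly_Mapping.keys_add[of x y] by blast
    moreover have "boundary (x + y) = z"
      using x(2) by (simp add: lin_add[OF lin_boundary])
    ultimately show ?case by blast
  qed
  from this[of z "Suc (card L)"] z show ?thesis
    using finL by (auto simp: rk_def less_Suc_eq_le intro!: card_mono)
qed

section \<open>Traces\<close>

lemma functional_finsum:
  fixes V :: "(complex, 'v) module" and h :: "'v \<Rightarrow> complex"
  assumes V: "vectorspace class_ring V" and E: "finite E" and w: "w \<in> E \<rightarrow> carrier V"
    and add: "\<And>x y. x \<in> carrier V \<Longrightarrow> y \<in> carrier V \<Longrightarrow> h (x \<oplus>\<^bsub>V\<^esub> y) = h x + h y"
    and scale: "\<And>c x. x \<in> carrier V \<Longrightarrow> h (c \<odot>\<^bsub>V\<^esub> x) = c * h x"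
  shows "h (finsum V (\<lambda>s. c s \<odot>\<^bsub>V\<^esub> w s) E) = (\<Sum>s\<in>E. c s * h (w s))"
proof -
  interpret vectorspace "class_ring :: complex ring" V by (rule V)
  show ?thesis
    using E w
  proof (induction rule: finite_induct)
    case empty
    have "h \<zero>\<^bsub>V\<^esub> = h (0 \<odot>\<^bsub>V\<^esub> \<zero>\<^bsub>V\<^esub>)"
      using smult_l_null[OF zero_closed] by simp
    then show ?case using scale[of "\<zero>\<^bsub>V\<^esub>" 0] by simp
  next
    case (insert s E)
    have c: "c x \<odot>\<^bsub>V\<^esub> w x \<in> carrier V" if "x \<in> insert s E" for x
      using insert.prems that by (intro smult_closed) auto
    have "finsum V (\<lambda>s. c s \<odot>\<^bsub>V\<^esub> w s) (insert s E) =
        c s \<odot>\<^bsub>V\<^esub> w s \<oplus>\<^bsub>V\<^esub> finsum V (\<lambda>s. c s \<odot>\<^bsub>V\<^esub> w s) E"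
      using insert.hyps c by (intro finsum_insert) auto
    moreover have "finsum V (\<lambda>s. c s \<odot>\<^bsub>V\<^esub> w s) E \<in> carrier V"
      using c by (intro finsum_closed) auto
    moreover have "w s \<in> carrier V" "w \<in> E \<rightarrow> carrier V"
      using insert.prems by auto
    ultimately show ?case
      using insert c by (simp add: add scale)
  qed
qed

text \<open>
  The spanning family \<open>v\<close> with coordinate functionals \<open>lam\<close> need not be a basis; in particular the
  lemma contains the independence of the trace from the basis selected in \<open>vs_trace\<close>.
\<close>

lemma vs_trace_frame:
  fixes V :: "(complex, 'v) module" and lam :: "'s \<Rightarrow> 'v \<Rightarrow> complex"
  assumes V: "vectorspace class_ring V" and D: "finite D" and v: "v \<in> D \<rightarrow> carrier V"
    and lam_add: "\<And>s x y. s \<in> D \<Longrightarrow> x \<in> carrier V \<Longrightarrow> y \<in> carrier V \<Longrightarrow>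
      lam s (x \<oplus>\<^bsub>V\<^esub> y) = lam s x + lam s y"
    and lam_scale: "\<And>s c x. s \<in> D \<Longrightarrow> x \<in> carrier V \<Longrightarrow> lam s (c \<odot>\<^bsub>V\<^esub> x) = c * lam s x"
    and frame: "\<And>x. x \<in> carrier V \<Longrightarrow> x = finsum V (\<lambda>s. lam s x \<odot>\<^bsub>V\<^esub> v s) D"
    and \<phi>: "\<And>x. x \<in> carrier V \<Longrightarrow> \<phi> x \<in> carrier V"
    and \<phi>_add: "\<And>x y. x \<in> carrier V \<Longrightarrow> y \<in> carrier V \<Longrightarrow> \<phi> (x \<oplus>\<^bsub>V\<^esub> y) = \<phi> x \<oplus>\<^bsub>V\<^esub> \<phi> y"
    and \<phi>_scale: "\<And>c x. x \<in> carrier V \<Longrightarrow> \<phi> (c \<odot>\<^bsub>V\<^esub> x) = c \<odot>\<^bsub>V\<^esub> \<phi> x"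
  shows "vs_trace V \<phi> = (\<Sum>s\<in>D. lam s (\<phi> (v s)))"
proof -
  interpret vectorspace "class_ring :: complex ring" V by (rule V)
  have vD: "v ` D \<subseteq> carrier V" using v by auto
  interpret sp: LinearCombinations.submodule "class_ring :: complex ring" "span (v ` D)" V
    by (rule span_is_submodule[OF vD])
  \<comment> \<open>The frame spans, so the space is finite-dimensional and the choice of a basis in
    \<open>vs_trace\<close> is a choice from a nonempty set.\<close>
  have "carrier V \<subseteq> span (v ` D)"
  proof
    fix x assume x: "x \<in> carrier V"
    have "finsum V (\<lambda>s. lam s x \<odot>\<^bsub>V\<^esub> v s) E \<in> span (v ` D)" if "E \<subseteq> D" for E
      using finite_subset[OF that D] that
    proof (induction rule: finite_induct)
      case empty
      then show ?case by simp
    next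
      case (insert s E)
      have "finsum V (\<lambda>s. lam s x \<odot>\<^bsub>V\<^esub> v s) (insert s E) =
          lam s x \<odot>\<^bsub>V\<^esub> v s \<oplus>\<^bsub>V\<^esub> finsum V (\<lambda>s. lam s x \<odot>\<^bsub>V\<^esub> v s) E"
        using insert v by (intro finsum_insert) (auto intro!: smult_closed)
      moreover have "v s \<in> span (v ` D)"
        using in_own_span[OF vD] insert.prems by auto
      ultimately show ?case
        using insert by (auto intro!: sp.m_closed sp.smult_closed)
    qed
    from this[OF order.refl] show "x \<in> span (v ` D)"
      by (subst frame[OF x])
  qed
  then have "gen_set (v ` D)"
    using sp.subset by blast
  then have "fin_dim"
    unfolding fin_dim_def using D vD by (intro exI[of _ "v ` D"]) auto
  then have ex: "\<exists>B. finite B \<and> basis B"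
    by (rule finite_basis_exists)
  define B where "B = (SOME B. finite B \<and> basis B)"
  have B: "finite B" "basis B"
    using someI_ex[OF ex] by (auto simp: B_def)
  have BV: "B \<subseteq> carrier V" using B(2) by (simp add: basis_def)
  have uniq: "\<exists>!a. a \<in> B \<rightarrow>\<^sub>E carrier (class_ring :: complex ring) \<and> lincomb a B = x"
    if "x \<in> carrier V" for x
    using basis_criterion[OF B(1) BV] B(2) that by blast
  define K where "K = basis_coords V B"
  have K: "K x \<in> B \<rightarrow>\<^sub>E carrier (class_ring :: complex ring)" "lincomb (K x) B = x"
    if "x \<in> carrier V" for x
    using theI'[OF uniq[OF that]] by (simp_all add: K_def basis_coords_def)
  have K_eqI: "K x b = a b" if "x \<in> carrier V" "lincomb a B = x" "b \<in> B" for x a b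
  proof -
    have "restrict a B \<in> B \<rightarrow>\<^sub>E carrier (class_ring :: complex ring)" by auto
    moreover have "lincomb (restrict a B) B = x"
      unfolding that(2)[symmetric] using BV by (intro lincomb_cong) auto
    ultimately have "K x = restrict a B"
      using uniq[OF that(1)] K[OF that(1)] by blast
    then show ?thesis using that(3) by simp
  qed
  have K_add: "K (x \<oplus>\<^bsub>V\<^esub> y) b = K x b + K y b"
    if "x \<in> carrier V" "y \<in> carrier V" "b \<in> B" for x y b
    using lincomb_sum[OF B(1) BV, of "K x" "K y"] K that
    by (intro K_eqI) auto
  have K_scale: "K (c \<odot>\<^bsub>V\<^esub> x) b = c * K x b" if "x \<in> carrier V" "b \<in> B" for c x b
    using lincomb_smult[OF BV, of "K x" c] K that by (intro K_eqI) auto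
  \<comment> \<open>Each \<phi> b is expanded in the frame, the sums are exchanged, and each v s is
    expanded in the basis; this carries the diagonal sum from the basis over to the frame.\<close>
  have "vs_trace V \<phi> = (\<Sum>b\<in>B. K (\<phi> b) b)"
    by (simp add: vs_trace_def B_def K_def Let_def)
  also have "\<dots> = (\<Sum>b\<in>B. \<Sum>s\<in>D. lam s (\<phi> b) * K (v s) b)"
  proof (rule sum.cong[OF refl])
    fix b assume b: "b \<in> B"
    then have "\<phi> b \<in> carrier V" using \<phi> BV by auto
    then have "K (\<phi> b) b = K (finsum V (\<lambda>s. lam s (\<phi> b) \<odot>\<^bsub>V\<^esub> v s) D) b"
      by (rule arg_cong[OF frame, of _ "\<lambda>x. K x b"])
    also have "\<dots> = (\<Sum>s\<in>D. lam s (\<phi> b) * K (v s) b)"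
      using K_add K_scale b by (intro functional_finsum[OF V D v]) auto
    finally show "K (\<phi> b) b = (\<Sum>s\<in>D. lam s (\<phi> b) * K (v s) b)" .
  qed
  also have "\<dots> = (\<Sum>s\<in>D. \<Sum>b\<in>B. K (v s) b * lam s (\<phi> b))"
    by (subst sum.swap) (simp add: mult.commute)
  also have "\<dots> = (\<Sum>s\<in>D. lam s (\<phi> (v s)))"
  proof (rule sum.cong[OF refl])
    fix s assume s: "s \<in> D"
    then have vs: "v s \<in> carrier V" using v by auto
    have "lam s (\<phi> (v s)) = lam s (\<phi> (finsum V (\<lambda>b. K (v s) b \<odot>\<^bsub>V\<^esub> b) B))"
      using K(2)[OF vs] by (simp add: lincomb_def)
    also have "\<dots> = (\<Sum>b\<in>B. K (v s) b * lam s (\<phi> b))"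
      using BV by (intro functional_finsum[OF V B(1), where w = "\<lambda>b. b" and h = "\<lambda>x. lam s (\<phi> x)"])
        (auto simp: \<phi>_add \<phi>_scale lam_add[OF s] lam_scale[OF s] \<phi>)
    finally show "(\<Sum>b\<in>B. K (v s) b * lam s (\<phi> b)) = lam s (\<phi> (v s))" ..
  qed
  finally show ?thesis .
qed

text \<open>
  Covers the chain spaces (\<open>g\<close> the identity) as well as the top homology, whose elements are the
  singleton cosets of cycles (\<open>g z = {z}\<close>).
\<close>

locale chain_image =
  fixes V :: "(complex, 'v) module" and g :: "(cell \<Rightarrow>\<^sub>0 complex) \<Rightarrow> 'v"
    and Z :: "(cell \<Rightarrow>\<^sub>0 complex) set"
  assumes carrier: "carrier V = g ` Z"
    and inj: "inj_on g Z"
    and Z_zero: "0 \<in> Z"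
    and Z_add: "\<And>x y. x \<in> Z \<Longrightarrow> y \<in> Z \<Longrightarrow> x + y \<in> Z"
    and Z_scale: "\<And>c x. x \<in> Z \<Longrightarrow> scl c x \<in> Z"
    and zero: "\<zero>\<^bsub>V\<^esub> = g 0"
    and add: "\<And>x y. x \<in> Z \<Longrightarrow> y \<in> Z \<Longrightarrow> g x \<oplus>\<^bsub>V\<^esub> g y = g (x + y)"
    and scale: "\<And>c x. x \<in> Z \<Longrightarrow> c \<odot>\<^bsub>V\<^esub> g x = g (scl c x)"
begin

lemma vectorspace: "vectorspace class_ring V"
proof -
  have "abelian_group V"
  proof (rule abelian_groupI)
    fix x assume "x \<in> carrier V"
    then obtain z where z: "x = g z" "z \<in> Z" by (auto simp: carrier)
    have "scl (-1) z + z = 0"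
      by (rule poly_mapping_eqI) (simp add: lookup_add)
    then show "\<exists>y\<in>carrier V. y \<oplus>\<^bsub>V\<^esub> x = \<zero>\<^bsub>V\<^esub>"
      using z Z_scale[OF z(2), of "-1"]
      by (intro bexI[of _ "g (scl (-1) z)"]) (auto simp: add zero carrier)
  qed (auto simp: carrier zero add Z_zero Z_add algebra_simps)
  moreover have "cring (class_ring :: complex ring)"
    by unfold_locales
  ultimately have "module class_ring V"
    by (intro moduleI)
      (auto simp: carrier add scale Z_add Z_scale chain.scale_left_distrib chain.scale_right_distrib)
  then show ?thesis
    using class_field by (simp add: vectorspace_def)
qed

lemma finsum_image:
  assumes "finite E" "\<And>s. s \<in> E \<Longrightarrow> f s \<in> Z"
  shows "finsum V (\<lambda>s. g (f s)) E = g (sum f E) \<and> sum f E \<in> Z"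
proof -
  interpret vectorspace "class_ring :: complex ring" V by (rule vectorspace)
  show ?thesis
    using assms
  proof (induction rule: finite_induct)
    case empty
    then show ?case by (simp add: zero Z_zero)
  next
    case (insert s E)
    then have "finsum V (\<lambda>s. g (f s)) (insert s E) = g (f s) \<oplus>\<^bsub>V\<^esub> finsum V (\<lambda>s. g (f s)) E"
      by (intro finsum_insert) (auto simp: carrier)
    then show ?case using insert by (simp add: add Z_add)
  qed
qed

text \<open>An element z of \<open>Z\<close> satisfies z = e z, so applying \<open>e\<close> to its
  expansion in cells writes z as a combination of the projected cells, with the cell coordinates of
  z as coefficients. The projected cells, usually linearly dependent, are therefore a frame for
  \<open>Z\<close>.\<close>

lemma vs_trace_projection:
  assumes D: "finite D" "\<And>z. z \<in> Z \<Longrightarrow> Poly_Mapping.keys z \<subseteq> D"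
    and e: "lin e" "\<And>s. s \<in> D \<Longrightarrow> e (Poly_Mapping.single s 1) \<in> Z" "\<And>z. z \<in> Z \<Longrightarrow> e z = z"
    and \<phi>: "lin \<phi>" "\<And>z. z \<in> Z \<Longrightarrow> \<phi> z \<in> Z" "\<And>z. z \<in> Z \<Longrightarrow> \<psi> (g z) = g (\<phi> z)"
  shows "vs_trace V \<psi> = (\<Sum>s\<in>D. Poly_Mapping.lookup (\<phi> (e (Poly_Mapping.single s 1))) s)"
proof -
  define lam where "lam s x = Poly_Mapping.lookup (inv_into Z g x) s" for s x
  define v where "v s = g (e (Poly_Mapping.single s 1))" for s
  have lam: "lam s (g z) = Poly_Mapping.lookup z s" if "z \<in> Z" for s z
    using that inj by (simp add: lam_def)
  have "vs_trace V \<psi> = (\<Sum>s\<in>D. lam s (\<psi> (v s)))"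
  proof (rule vs_trace_frame[OF vectorspace D(1)])
    show "v \<in> D \<rightarrow> carrier V" using e by (auto simp: v_def carrier)
    fix x assume "x \<in> carrier V"
    then obtain z where z: "x = g z" "z \<in> Z" by (auto simp: carrier)
    have "finsum V (\<lambda>s. lam s x \<odot>\<^bsub>V\<^esub> v s) D =
        finsum V (\<lambda>s. g (scl (Poly_Mapping.lookup z s) (e (Poly_Mapping.single s 1)))) D"
    proof -
      interpret vectorspace "class_ring :: complex ring" V by (rule vectorspace)
      show ?thesis
        using z e by (intro finsum_cong') (auto simp: lam v_def scale carrier Z_scale)
    qed
    also have "\<dots> = g (\<Sum>s\<in>D. scl (Poly_Mapping.lookup z s) (e (Poly_Mapping.single s 1)))"
      by (rule conjunct1[OF finsum_image[OF D(1)]]) (intro Z_scale e(2))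
    also have "\<dots> = g (e z)"
      using lin_expand[OF e(1) D(1) D(2)[OF z(2)]] by simp
    also have "\<dots> = x"
      by (simp only: e(3)[OF z(2)] z(1))
    finally show "x = finsum V (\<lambda>s. lam s x \<odot>\<^bsub>V\<^esub> v s) D"
      by (rule sym)
  qed (auto simp: carrier lam add scale \<phi> Z_add Z_scale lookup_add lin_add[OF \<phi>(1)] lin_scale[OF \<phi>(1)])
  then show ?thesis
    using e(2) \<phi> lam by (simp add: v_def)
qed

end

section \<open>Traces on chains, cycles and homology\<close>

definition chains :: "int set \<Rightarrow> int set \<Rightarrow> nat \<Rightarrow> (cell \<Rightarrow>\<^sub>0 complex) set" where
  "chains A M i = {f. Poly_Mapping.keys f \<subseteq> Delta A M i}"

lemma chains_scale: "f \<in> chains A M i \<Longrightarrow> scl c f \<in> chains A M i"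
  by (auto simp: chains_def in_keys_iff subset_iff)

lemma chains_add: "f \<in> chains A M i \<Longrightarrow> g \<in> chains A M i \<Longrightarrow> f + g \<in> chains A M i"
  using Poly_Mapping.keys_add[of f g] by (auto simp: chains_def)

lemma chains_diff: "f \<in> chains A M i \<Longrightarrow> g \<in> chains A M i \<Longrightarrow> f - g \<in> chains A M i"
  using keys_diff[of f g] by (auto simp: chains_def)

lemma chain_image_chain_space: "chain_image (chain_space A M i) (\<lambda>z. z) (chains A M i)"
  by unfold_locales (auto simp: chain_space_def chains_def[symmetric] chains_add chains_scale,
      simp add: chains_def)

lemma cycles_eq: "cycles A M i = {f \<in> chains A M i. boundary f = 0}"
  by (simp add: cycles_def chain_space_def chains_def)

lemma chain_image_homology:
  assumes "Delta A M (Suc i) = {}"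
  shows "chain_image (homology A M i) (\<lambda>z. {z}) (cycles A M i)"
proof -
  have b: "boundaries A M i = {0}"
    using assms by (simp add: boundaries_def chain_space_def lin_zero[OF lin_boundary])
  have c: "carrier (homology A M i) = (\<lambda>z. {z}) ` cycles A M i"
    unfolding homology_def quot_space_def b A_RCOSETS_def' a_r_coset_def'
    by (auto simp: chain_space_def)
  have 0: "(0 :: cell \<Rightarrow>\<^sub>0 complex) \<in> cycles A M i"
    by (simp add: cycles_eq chains_def lin_zero[OF lin_boundary])
  show ?thesis
    by unfold_locales
      (use 0 c in \<open>auto simp: cycles_eq chains_add chains_scale lin_add[OF lin_boundary]
        lin_scale[OF lin_boundary] homology_def quot_space_def b set_add_def' chain_space_def\<close>)
qed

definition op_trace :: "cell set \<Rightarrow> ((cell \<Rightarrow>\<^sub>0 complex) \<Rightarrow> (cell \<Rightarrow>\<^sub>0 complex)) \<Rightarrow> complex" where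
  "op_trace D F = (\<Sum>s\<in>D. Poly_Mapping.lookup (F (Poly_Mapping.single s 1)) s)"

text \<open>Both sides are the same double sum of products of matrix entries of \<open>P\<close> and
  \<open>Q\<close>. The support conditions allow the inner argument to be expanded over a finite set
  of cells.\<close>

lemma op_trace_commute:
  assumes "finite D" "finite D'" "lin P" "lin Q"
    and "\<And>s. s \<in> D \<Longrightarrow> Poly_Mapping.keys (P (Poly_Mapping.single s 1)) \<subseteq> D'"
    and "\<And>s. s \<in> D' \<Longrightarrow> Poly_Mapping.keys (Q (Poly_Mapping.single s 1)) \<subseteq> D"
  shows "op_trace D (Q \<circ> P) = op_trace D' (P \<circ> Q)"
proof -
  let ?p = "\<lambda>s t. Poly_Mapping.lookup (P (Poly_Mapping.single s 1)) t"
  let ?q = "\<lambda>s t. Poly_Mapping.lookup (Q (Poly_Mapping.single s 1)) t"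
  have "op_trace D (Q \<circ> P) = (\<Sum>s\<in>D. \<Sum>t\<in>D'. ?p s t * ?q t s)"
    unfolding op_trace_def comp_def
    by (intro sum.cong refl, subst lin_expand[OF assms(4,2) assms(5)]) (auto simp: lookup_sum)
  also have "\<dots> = (\<Sum>t\<in>D'. \<Sum>s\<in>D. ?q t s * ?p s t)"
    by (subst sum.swap) (simp add: mult.commute)
  also have "\<dots> = op_trace D' (P \<circ> Q)"
    unfolding op_trace_def comp_def
    by (intro sum.cong refl, subst lin_expand[OF assms(3,1) assms(6)]) (auto simp: lookup_sum)
  finally show ?thesis .
qed

lemma lin_comp:
  assumes "lin F" "lin G"
  shows "lin (F \<circ> G)"
  by (rule linI)
    (simp_all add: lin_add[OF assms(1)] lin_add[OF assms(2)] lin_scale[OF assms(1)] lin_scale[OF assms(2)])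

lemma single_chains [simp]: "s \<in> Delta A M i \<Longrightarrow> Poly_Mapping.single s 1 \<in> chains A M i"
  by (simp add: chains_def)

text \<open>The right-hand side is the alternating sum that the trace on i-cycles must equal.
  Cyclicity turns the trace of \<sigma> h \<partial> into that of \<partial> \<sigma> h, and
  equivariance of the boundary makes it the trace of \<sigma> \<partial> h, that is, of \<sigma> e
  one degree lower.\<close>

lemma exists_cycle_projection:
  assumes A: "finite A" and M: "finite M" "M \<noteq> {}" and \<sigma>: "\<sigma> permutes A" and i: "i \<le> card A"
  shows "\<exists>e. lin e \<and> (\<forall>f\<in>chains A M i. e f \<in> cycles A M i) \<and> (\<forall>f\<in>cycles A M i. e f = f) \<and>
    op_trace (Delta A M i) (chain_act \<sigma> \<circ> e) =
      (\<Sum>j=0..i. (-1) ^ (i - j) * op_trace (Delta A M j) (chain_act \<sigma>))"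
  using i
proof (induction i)
  case 0
  have "lin (\<lambda>f. f)" by (rule linI) auto
  moreover have "cycles A M 0 = chains A M 0"
    using boundary_Delta_0 by (auto simp: cycles_eq chains_def)
  ultimately show ?case by (intro exI[of _ "\<lambda>f. f"]) (simp add: comp_def)
next
  case (Suc i)
  then obtain e where e: "lin e" "\<And>f. f \<in> chains A M i \<Longrightarrow> e f \<in> cycles A M i"
    "\<And>f. f \<in> cycles A M i \<Longrightarrow> e f = f"
    and tr: "op_trace (Delta A M i) (chain_act \<sigma> \<circ> e) =
      (\<Sum>j=0..i. (-1) ^ (i - j) * op_trace (Delta A M j) (chain_act \<sigma>))"
    using Suc.IH[OF Suc_leD[OF Suc.prems]] by blast
  \<comment> \<open>Exactness is used in degree i, one below the degree being constructed:
    \<open>Suc i\<close> at most \<open>card A\<close> is just what it requires.\<close>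
  have "\<forall>s\<in>Delta A M i. \<exists>y. y \<in> chains A M (Suc i) \<and> boundary y = e (Poly_Mapping.single s 1)"
  proof
    fix s assume "s \<in> Delta A M i"
    then have "e (Poly_Mapping.single s 1) \<in> cycles A M i" using e(2) by simp
    then show "\<exists>y. y \<in> chains A M (Suc i) \<and> boundary y = e (Poly_Mapping.single s 1)"
      using exact_below_top[OF A M, of i "e (Poly_Mapping.single s 1)"] Suc.prems
      by (auto simp: cycles_eq chains_def)
  qed
  from bchoice[OF this] obtain H where
    H: "\<And>s. s \<in> Delta A M i \<Longrightarrow> H s \<in> chains A M (Suc i)"
       "\<And>s. s \<in> Delta A M i \<Longrightarrow> boundary (H s) = e (Poly_Mapping.single s 1)"
    by blast
  define h where "h = linext H"
  have h: "lin h" by (simp add: h_def lin_linext)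
  have h_chains: "h f \<in> chains A M (Suc i)" if "f \<in> chains A M i" for f
    using that H(1) unfolding h_def chains_def mem_Collect_eq by (intro keys_linext) auto
  have bh: "boundary (h f) = e f" if "f \<in> chains A M i" for f
  proof -
    have "(boundary \<circ> h) f = e f"
      by (rule lin_eqI[OF lin_comp[OF lin_boundary h] e(1), of "Delta A M i"])
        (use that H in \<open>auto simp: h_def chains_def\<close>)
    then show ?thesis by simp
  qed
  have b_chains: "boundary f \<in> chains A M i" if "f \<in> chains A M (Suc i)" for f
    using keys_boundary that by (auto simp: chains_def)
  have b_cycles: "boundary f \<in> cycles A M i" if "f \<in> chains A M (Suc i)" for f
    using b_chains[OF that] boundary_boundary that by (auto simp: cycles_eq chains_def)
  \<comment> \<open>For an (i+1)-chain f, the boundary of \<open>e' f\<close> is \<partial>f - e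
    (\<partial>f), which is 0 because \<open>e\<close> fixes the cycle \<partial>f. If f is a cycle,
    the correction term is \<open>h 0\<close>.\<close>
  define e' where "e' f = f - h (boundary f)" for f
  have "lin e'"
    by (rule linI) (simp_all add: e'_def lin_add[OF h] lin_add[OF lin_boundary]
        lin_scale[OF h] lin_scale[OF lin_boundary] chain.scale_right_diff_distrib)
  moreover have "e' f \<in> cycles A M (Suc i)" if f: "f \<in> chains A M (Suc i)" for f
    using f h_chains[OF b_chains[OF f]] bh[OF b_chains[OF f]] e(3)[OF b_cycles[OF f]]
    by (auto simp: e'_def cycles_eq chains_diff lin_diff[OF lin_boundary])
  moreover have "e' f = f" if "f \<in> cycles A M (Suc i)" for f
    using that by (simp add: e'_def cycles_eq lin_zero[OF h])
  moreover have "op_trace (Delta A M (Suc i)) (chain_act \<sigma> \<circ> e') =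
      (\<Sum>j=0..Suc i. (-1) ^ (Suc i - j) * op_trace (Delta A M j) (chain_act \<sigma>))"
  proof -
    have "op_trace (Delta A M (Suc i)) (chain_act \<sigma> \<circ> e') =
        op_trace (Delta A M (Suc i)) (chain_act \<sigma>) -
        op_trace (Delta A M (Suc i)) ((chain_act \<sigma> \<circ> h) \<circ> boundary)"
      by (simp add: op_trace_def e'_def lin_diff[OF lin_chain_act] lookup_minus sum_subtractf)
    also have "op_trace (Delta A M (Suc i)) ((chain_act \<sigma> \<circ> h) \<circ> boundary) =
        op_trace (Delta A M i) (boundary \<circ> (chain_act \<sigma> \<circ> h))"
    proof (rule op_trace_commute[OF _ _ lin_boundary lin_comp[OF lin_chain_act h]])
      show "finite (Delta A M (Suc i))" "finite (Delta A M i)"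
        using A M by (simp_all add: finite_Delta)
      show "Poly_Mapping.keys (boundary (Poly_Mapping.single s 1)) \<subseteq> Delta A M i"
        if "s \<in> Delta A M (Suc i)" for s
        using that by (intro keys_boundary) simp
      show "Poly_Mapping.keys ((chain_act \<sigma> \<circ> h) (Poly_Mapping.single s 1)) \<subseteq> Delta A M (Suc i)"
        if "s \<in> Delta A M i" for s
        using keys_chain_act[OF \<sigma>] h_chains[OF single_chains[OF that]] by (simp add: chains_def)
    qed
    also have "\<dots> = op_trace (Delta A M i) (chain_act \<sigma> \<circ> e)"
      by (simp add: op_trace_def boundary_chain_act bh)
    finally show ?thesis
      unfolding tr by (simp add: sum_negf[symmetric] Suc_diff_le comp_def)
  qed
  ultimately show ?case by blast
qed

lemma vs_trace_chain_space:
  assumes "finite A" "finite M" "\<sigma> permutes A"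
  shows "vs_trace (chain_space A M i) (chain_act \<sigma>) = op_trace (Delta A M i) (chain_act \<sigma>)"
proof -
  interpret chain_image "chain_space A M i" "\<lambda>z. z" "chains A M i"
    by (rule chain_image_chain_space)
  have "lin (\<lambda>f. f)" by (rule linI) auto
  then show ?thesis
    unfolding op_trace_def
    by (intro vs_trace_projection[where e = "\<lambda>f. f"] finite_Delta lin_chain_act)
      (use assms keys_chain_act[OF assms(3)] in \<open>auto simp: chains_def\<close>)
qed

lemma vs_trace_homology:
  assumes A: "finite A" and M: "finite M" "M \<noteq> {}" and \<sigma>: "\<sigma> permutes A"
  shows "vs_trace (homology A M (card A)) (homology_act \<sigma>) =
    (\<Sum>i=0..card A. (-1) ^ (card A - i) * vs_trace (chain_space A M i) (chain_act \<sigma>))"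
proof -
  let ?k = "card A"
  have empty: "Delta A M (Suc ?k) = {}"
  proof -
    have "length w \<le> ?k" if "distinct w" "set w \<subseteq> A" for w
      using card_mono[OF A that(2)] distinct_card[OF that(1)] by simp
    then show ?thesis by (fastforce simp: Delta_def)
  qed
  interpret chain_image "homology A M ?k" "\<lambda>z. {z}" "cycles A M ?k"
    by (rule chain_image_homology[OF empty])
  obtain e where e: "lin e" "\<And>f. f \<in> chains A M ?k \<Longrightarrow> e f \<in> cycles A M ?k"
    "\<And>f. f \<in> cycles A M ?k \<Longrightarrow> e f = f"
    and tr: "op_trace (Delta A M ?k) (chain_act \<sigma> \<circ> e) =
      (\<Sum>j=0..?k. (-1) ^ (?k - j) * op_trace (Delta A M j) (chain_act \<sigma>))"
    using exists_cycle_projection[OF A M \<sigma> order.refl] by blast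
  have "vs_trace (homology A M ?k) (homology_act \<sigma>) = op_trace (Delta A M ?k) (chain_act \<sigma> \<circ> e)"
    unfolding op_trace_def comp_def
  proof (rule vs_trace_projection[OF finite_Delta[OF A M(1)] _ e(1) _ _ lin_chain_act])
    show "chain_act \<sigma> z \<in> cycles A M ?k" if "z \<in> cycles A M ?k" for z
      using that keys_chain_act[OF \<sigma>, of z M ?k]
      by (auto simp: cycles_eq chains_def boundary_chain_act lin_zero[OF lin_chain_act])
  qed (auto simp: homology_act_def e, auto simp: cycles_eq chains_def)
  then show ?thesis
    using A M(1) \<sigma> by (simp add: tr vs_trace_chain_space)
qed

section \<open>Permutations and their cycle types\<close>

text \<open>The maps that are constant on the cycles of \<sigma>. With Boolean values their number
  determines the number of cycles; with values in the variable indices they count the terms of a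
  product of power sums.\<close>

definition invariant_maps :: "'a set \<Rightarrow> ('a \<Rightarrow> 'a) \<Rightarrow> 'b set \<Rightarrow> ('a \<Rightarrow> 'b) set" where
  "invariant_maps A \<sigma> B = {f \<in> A \<rightarrow>\<^sub>E B. \<forall>x\<in>A. f (\<sigma> x) = f x}"

lemma orbit_facts:
  assumes "\<sigma> permutes A" "finite A"
  shows "x \<in> orbit \<sigma> x" "x \<in> A \<Longrightarrow> orbit \<sigma> x \<subseteq> A" "finite (orbit \<sigma> x)"
    "y \<in> orbit \<sigma> x \<Longrightarrow> orbit \<sigma> y = orbit \<sigma> x" "orbit \<sigma> (\<sigma> x) = orbit \<sigma> x"
proof -
  have p: "permutation \<sigma>" using assms permutation_permutes by blast
  show x: "x \<in> orbit \<sigma> x" by (rule permutation_self_in_orbit[OF p])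
  show "x \<in> A \<Longrightarrow> orbit \<sigma> x \<subseteq> A" by (rule permutes_orbit_subset[OF assms(1)])
  show "finite (orbit \<sigma> x)" by (rule finite_orbit[OF x])
  show eq: "orbit \<sigma> y = orbit \<sigma> x" if "y \<in> orbit \<sigma> x" for y
    using orbit_cyclic_eq3[OF cyclic_on_orbit[OF assms] that] by simp
  show "orbit \<sigma> (\<sigma> x) = orbit \<sigma> x" by (rule eq[OF orbit.base])
qed

lemma invariant_maps_orbit:
  assumes "\<sigma> permutes A" "finite A" "f \<in> invariant_maps A \<sigma> B" "x \<in> A" "y \<in> orbit \<sigma> x"
  shows "f y = f x"
  using assms(5)
proof (induction rule: orbit.induct)
  case base
  then show ?case using assms(3,4) by (simp add: invariant_maps_def)
next
  case (step y)
  then have "y \<in> A" using orbit_facts(2)[OF assms(1,2,4)] by blast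
  then show ?case using step assms(3) by (simp add: invariant_maps_def)
qed

lemma bij_betw_invariant_maps:
  assumes \<sigma>: "\<sigma> permutes A" "finite A"
  shows "bij_betw (\<lambda>g. \<lambda>x\<in>A. g (orbit \<sigma> x)) ((orbit \<sigma> ` A) \<rightarrow>\<^sub>E B) (invariant_maps A \<sigma> B)"
proof (rule bij_betw_byWitness[where f' = "\<lambda>f. \<lambda>C\<in>orbit \<sigma> ` A. f (SOME x. x \<in> A \<and> orbit \<sigma> x = C)"])
  have some: "(SOME y. y \<in> A \<and> orbit \<sigma> y = orbit \<sigma> x) \<in> A \<and>
      orbit \<sigma> (SOME y. y \<in> A \<and> orbit \<sigma> y = orbit \<sigma> x) = orbit \<sigma> x" if "x \<in> A" for x
    by (rule someI[of "\<lambda>y. y \<in> A \<and> orbit \<sigma> y = orbit \<sigma> x" x]) (use that in simp)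
  show "\<forall>g\<in>(orbit \<sigma> ` A) \<rightarrow>\<^sub>E B. (\<lambda>C\<in>orbit \<sigma> ` A. (\<lambda>x\<in>A. g (orbit \<sigma> x)) (SOME x. x \<in> A \<and> orbit \<sigma> x = C)) = g"
  proof
    fix g assume g: "g \<in> (orbit \<sigma> ` A) \<rightarrow>\<^sub>E B"
    show "(\<lambda>C\<in>orbit \<sigma> ` A. (\<lambda>x\<in>A. g (orbit \<sigma> x)) (SOME x. x \<in> A \<and> orbit \<sigma> x = C)) = g"
    proof (rule extensionalityI[of _ "orbit \<sigma> ` A"])
      fix C assume "C \<in> orbit \<sigma> ` A"
      then obtain x where "x \<in> A" "C = orbit \<sigma> x" by blast
      then show "(\<lambda>C\<in>orbit \<sigma> ` A. (\<lambda>x\<in>A. g (orbit \<sigma> x)) (SOME x. x \<in> A \<and> orbit \<sigma> x = C)) C = g C"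
        using some[of x] by simp
    qed (use g in \<open>auto simp: PiE_def\<close>)
  qed
  show "\<forall>f\<in>invariant_maps A \<sigma> B. (\<lambda>x\<in>A. (\<lambda>C\<in>orbit \<sigma> ` A. f (SOME x. x \<in> A \<and> orbit \<sigma> x = C)) (orbit \<sigma> x)) = f"
  proof
    fix f assume f: "f \<in> invariant_maps A \<sigma> B"
    show "(\<lambda>x\<in>A. (\<lambda>C\<in>orbit \<sigma> ` A. f (SOME x. x \<in> A \<and> orbit \<sigma> x = C)) (orbit \<sigma> x)) = f"
    proof (rule extensionalityI[of _ A])
      fix x assume x: "x \<in> A"
      let ?y = "SOME y. y \<in> A \<and> orbit \<sigma> y = orbit \<sigma> x"
      have "?y \<in> orbit \<sigma> x"
        using some[OF x] orbit_facts(1)[OF \<sigma>, of ?y] by auto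
      then have "f ?y = f x" by (rule invariant_maps_orbit[OF \<sigma> f x])
      then show "(\<lambda>x\<in>A. (\<lambda>C\<in>orbit \<sigma> ` A. f (SOME x. x \<in> A \<and> orbit \<sigma> x = C)) (orbit \<sigma> x)) x = f x"
        using x by simp
    qed (use f in \<open>auto simp: PiE_def invariant_maps_def\<close>)
  qed
  show "(\<lambda>g. \<lambda>x\<in>A. g (orbit \<sigma> x)) ` ((orbit \<sigma> ` A) \<rightarrow>\<^sub>E B) \<subseteq> invariant_maps A \<sigma> B"
    using orbit_facts(5)[OF \<sigma>] permutes_in_image[OF \<sigma>(1)] by (auto simp: invariant_maps_def)
  show "(\<lambda>f. \<lambda>C\<in>orbit \<sigma> ` A. f (SOME x. x \<in> A \<and> orbit \<sigma> x = C)) ` invariant_maps A \<sigma> B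
      \<subseteq> (orbit \<sigma> ` A) \<rightarrow>\<^sub>E B"
  proof (rule image_subsetI)
    fix f assume f: "f \<in> invariant_maps A \<sigma> B"
    have "f (SOME y. y \<in> A \<and> orbit \<sigma> y = orbit \<sigma> x) \<in> B" if "x \<in> A" for x
      using some[OF that] f by (auto simp: invariant_maps_def PiE_def Pi_def)
    then show "(\<lambda>C\<in>orbit \<sigma> ` A. f (SOME x. x \<in> A \<and> orbit \<sigma> x = C)) \<in> (orbit \<sigma> ` A) \<rightarrow>\<^sub>E B"
      by auto
  qed
qed

lemma card_invariant_maps_bool:
  assumes "\<sigma> permutes A" "finite A"
  shows "card (invariant_maps A \<sigma> (UNIV :: bool set)) = 2 ^ card (orbit \<sigma> ` A)"
  using bij_betw_same_card[OF bij_betw_invariant_maps[OF assms, of "UNIV :: bool set"]] assms(2)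
  by (simp add: card_funcsetE)

lemma orbit_image_fixed_point:
  assumes "\<sigma> permutes A" "finite A" "\<sigma> a = a" "a \<in> A"
  shows "orbit \<sigma> ` A = insert {a} (orbit \<sigma> ` (A - {a}))" "{a} \<notin> orbit \<sigma> ` (A - {a})"
proof -
  have "orbit \<sigma> a = {a}" using assms(3) by (simp add: orbit_eq_singleton_iff)
  then show "orbit \<sigma> ` A = insert {a} (orbit \<sigma> ` (A - {a}))" using assms(4) by auto
  show "{a} \<notin> orbit \<sigma> ` (A - {a})"
    using orbit_facts(1)[OF assms(1,2)] by blast
qed

lemma permutes_remove_fixed_point:
  "\<sigma> permutes A \<Longrightarrow> \<sigma> a = a \<Longrightarrow> \<sigma> permutes (A - {a})"
  by (rule permutes_superset) auto

text \<open>
  Induction by cutting a point out of its cycle.  That this does not change the number of orbits is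
  read off from the number \<open>2 ^ card (orbit \<sigma> ` A)\<close> of invariant Boolean maps.
\<close>

lemma sign_eq_orbits:
  assumes "finite A" "\<sigma> permutes A"
  shows "sign \<sigma> = (-1) ^ (card A + card (orbit \<sigma> ` A))"
  using assms
proof (induction A arbitrary: \<sigma> rule: finite_induct)
  case empty
  then show ?case by (simp add: sign_id)
next
  case (insert x A)
  let ?A = "insert x A"
  have A: "?A - {x} = A" using insert.hyps by auto
  have finA: "finite ?A" using insert.hyps by simp
  show ?case
  proof (cases "\<sigma> x = x")
    case True
    then have \<sigma>: "\<sigma> permutes A"
      using permutes_remove_fixed_point[OF insert.prems True] A by simp
    have "card (orbit \<sigma> ` ?A) = Suc (card (orbit \<sigma> ` A))"
      using orbit_image_fixed_point[OF insert.prems finA True] insert.hyps A by simp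
    then show ?thesis using insert.IH[OF \<sigma>] insert.hyps by simp
  next
    case False
    \<comment> \<open>Composing with this transposition cuts \<open>x\<close> out of its cycle: the
      predecessor of \<open>x\<close> is sent on to \<open>\<sigma> x\<close>, and all other points
      of \<open>A\<close> move as before. The sign flips and the cardinality drops by one, so the
      formula survives if the number of cycles stays the same.\<close>
    define \<tau> where "\<tau> = Transposition.transpose x (\<sigma> x) \<circ> \<sigma>"
    have \<sigma>x: "\<sigma> x \<in> A" using permutes_in_image[OF insert.prems, of x] False by auto
    have pt: "Transposition.transpose x (\<sigma> x) permutes ?A"
      using \<sigma>x by (intro permutes_swap_id) auto
    have "\<tau> permutes ?A"
      unfolding \<tau>_def by (rule permutes_compose[OF insert.prems pt])
    moreover have "\<tau> x = x" by (simp add: \<tau>_def)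
    ultimately have \<tau>: "\<tau> permutes A"
      using permutes_remove_fixed_point[of \<tau> ?A x] A by simp
    have perm: "permutation \<sigma>" "permutation (Transposition.transpose x (\<sigma> x))"
      using insert.prems pt finA permutation_permutes by blast+
    have "sign \<tau> = - sign \<sigma>"
      unfolding \<tau>_def using False by (simp add: sign_compose[OF perm(2,1)] sign_swap_id)
    have \<tau>_eq: "\<tau> y = (if \<sigma> y = x then \<sigma> x else \<sigma> y)" if "y \<in> A" for y
      using that insert.hyps permutes_inj[OF insert.prems, THEN injD, of y x]
      by (auto simp: \<tau>_def Transposition.transpose_def)
    have "bij_betw (\<lambda>f. restrict f A) (invariant_maps ?A \<sigma> (UNIV :: bool set)) (invariant_maps A \<tau> UNIV)"
    \<comment> \<open>The point \<open>\<sigma> x\<close> lies in the same cycle as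
      \<open>x\<close>, so an invariant map must take the same value there; this restores the value
      lost by restricting.\<close>
    proof (rule bij_betw_byWitness[where f' = "\<lambda>h. h(x := h (\<sigma> x))"])
      show "\<forall>f\<in>invariant_maps ?A \<sigma> (UNIV :: bool set). (restrict f A)(x := restrict f A (\<sigma> x)) = f"
        using \<sigma>x by (auto simp: invariant_maps_def PiE_def extensional_def fun_eq_iff)
      show "\<forall>h\<in>invariant_maps A \<tau> (UNIV :: bool set). restrict (h(x := h (\<sigma> x))) A = h"
        using insert.hyps by (auto simp: invariant_maps_def PiE_def extensional_def fun_eq_iff)
      show "(\<lambda>f. restrict f A) ` invariant_maps ?A \<sigma> (UNIV :: bool set) \<subseteq> invariant_maps A \<tau> UNIV"
      proof (rule image_subsetI)
        fix f assume f: "f \<in> invariant_maps ?A \<sigma> (UNIV :: bool set)"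
        have "restrict f A (\<tau> y) = restrict f A y" if y: "y \<in> A" for y
        proof -
          have "\<tau> y \<in> A" using permutes_in_image[OF \<tau>] y by simp
          moreover have "f (\<tau> y) = f y"
          proof (cases "\<sigma> y = x")
            case True
            have "f (\<sigma> x) = f x" "f (\<sigma> y) = f y"
              using f y by (simp_all add: invariant_maps_def)
            then show ?thesis using True by (simp add: \<tau>_eq[OF y])
          next
            case False
            then show ?thesis using f y by (simp add: invariant_maps_def \<tau>_eq[OF y])
          qed
          ultimately show ?thesis using y by simp
        qed
        then show "restrict f A \<in> invariant_maps A \<tau> UNIV"
          unfolding invariant_maps_def by (intro CollectI conjI ballI) simp_all
      qed
      show "(\<lambda>h. h(x := h (\<sigma> x))) ` invariant_maps A \<tau> (UNIV :: bool set) \<subseteq> invariant_maps ?A \<sigma> UNIV"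
      proof (rule image_subsetI)
        fix h assume h: "h \<in> invariant_maps A \<tau> (UNIV :: bool set)"
        let ?f = "h(x := h (\<sigma> x))"
        have "?f (\<sigma> y) = ?f y" if y: "y \<in> ?A" for y
        proof (cases "y = x")
          case True
          then show ?thesis using False by simp
        next
          case yx: False
          then have yA: "y \<in> A" using y by simp
          have "h (\<tau> y) = h y" using h yA by (simp add: invariant_maps_def)
          then show ?thesis using yx by (simp add: \<tau>_eq[OF yA] split: if_splits)
        qed
        moreover have "?f \<in> ?A \<rightarrow>\<^sub>E UNIV"
          using h by (auto simp: invariant_maps_def PiE_def extensional_def)
        ultimately show "?f \<in> invariant_maps ?A \<sigma> UNIV"
          unfolding invariant_maps_def by (intro CollectI conjI ballI)
      qed
    qed
    from bij_betw_same_card[OF this]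
    have "(2::nat) ^ card (orbit \<sigma> ` ?A) = 2 ^ card (orbit \<tau> ` A)"
      unfolding card_invariant_maps_bool[OF insert.prems finA]
        card_invariant_maps_bool[OF \<tau> insert.hyps(1)] .
    then have "card (orbit \<sigma> ` ?A) = card (orbit \<tau> ` A)"
      by simp
    then show ?thesis
      using insert.IH[OF \<tau>] \<open>sign \<tau> = - sign \<sigma>\<close> insert.hyps by simp
  qed
qed

lemma mset_cycle_type: "mset (cycle_type A \<sigma>) = image_mset card (mset_set (orbit \<sigma> ` A))"
  by (simp add: cycle_type_def)

text \<open>The number of cycles is the length of the cycle type, and by
  \<open>sign_eq_orbits\<close> it determines the sign.\<close>

lemma sign_cycle_type:
  assumes "finite A" "\<sigma> permutes A" "\<tau> permutes A" "cycle_type A \<sigma> = cycle_type A \<tau>"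
  shows "sign \<sigma> = sign \<tau>"
proof -
  have "card (orbit \<sigma> ` A) = size (mset (cycle_type A \<sigma>))" for \<sigma>
    by (simp add: mset_cycle_type del: size_mset)
  then have "card (orbit \<sigma> ` A) = card (orbit \<tau> ` A)"
    using assms(4) by metis
  then show ?thesis using sign_eq_orbits assms by metis
qed

definition fixed_points :: "'a set \<Rightarrow> ('a \<Rightarrow> 'a) \<Rightarrow> 'a set" where
  "fixed_points A \<sigma> = {x \<in> A. \<sigma> x = x}"

text \<open>Fixed points correspond to the orbits of size one. This makes the characters of the
  chain spaces depend on the cycle type alone.\<close>

lemma card_fixed_points_eq:
  assumes "finite A" "\<sigma> permutes A"
  shows "card (fixed_points A \<sigma>) = count (mset (cycle_type A \<sigma>)) 1"
proof -
  have "count (mset (cycle_type A \<sigma>)) 1 = card {C \<in> orbit \<sigma> ` A. card C = 1}"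
    unfolding mset_cycle_type count_image_mset
    using assms(1) by (simp add: vimage_def Collect_conj_eq[symmetric] Int_def conj_commute)
  also have "{C \<in> orbit \<sigma> ` A. card C = 1} = (\<lambda>x. {x}) ` fixed_points A \<sigma>"
  proof (intro equalityI subsetI)
    fix C assume "C \<in> {C \<in> orbit \<sigma> ` A. card C = 1}"
    then obtain x where x: "x \<in> A" "C = orbit \<sigma> x" "card (orbit \<sigma> x) = 1" by auto
    then obtain y where "orbit \<sigma> x = {y}" by (auto simp: card_1_singleton_iff)
    moreover have "x \<in> orbit \<sigma> x" by (rule orbit_facts(1)[OF assms(2,1)])
    ultimately have "orbit \<sigma> x = {x}" by simp
    then have "C = {x}" "x \<in> fixed_points A \<sigma>"
      using x by (simp_all add: orbit_eq_singleton_iff fixed_points_def)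
    then show "C \<in> (\<lambda>x. {x}) ` fixed_points A \<sigma>" by blast
  next
    fix C assume "C \<in> (\<lambda>x. {x}) ` fixed_points A \<sigma>"
    then obtain x where x: "x \<in> A" "\<sigma> x = x" "C = {x}" by (auto simp: fixed_points_def)
    then have "orbit \<sigma> x = C" by (simp add: orbit_eq_singleton_iff)
    then show "C \<in> {C \<in> orbit \<sigma> ` A. card C = 1}" using x by auto
  qed
  also have "card \<dots> = card (fixed_points A \<sigma>)"
    by (rule card_image) (simp add: inj_on_def)
  finally show ?thesis ..
qed

section \<open>Counting injective words and label sequences\<close>

definition injective_words :: "'a set \<Rightarrow> nat \<Rightarrow> 'a list set" where
  "injective_words F i = {w. length w = i \<and> distinct w \<and> set w \<subseteq> F}"

lemma finite_injective_words: "finite F \<Longrightarrow> finite (injective_words F i)"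
  by (rule finite_subset[OF _ finite_lists_length_eq[of F i]]) (auto simp: injective_words_def)

lemma injective_words_0 [simp]: "injective_words F 0 = {[]}"
  by (auto simp: injective_words_def)

lemma card_injective_words_Suc:
  assumes "finite F"
  shows "card (injective_words F (Suc i)) = (\<Sum>a\<in>F. card (injective_words (F - {a}) i))"
proof -
  have "injective_words F (Suc i) = (\<lambda>(a, w). a # w) ` (SIGMA a:F. injective_words (F - {a}) i)"
  proof (intro equalityI subsetI)
    fix v assume "v \<in> injective_words F (Suc i)"
    then show "v \<in> (\<lambda>(a, w). a # w) ` (SIGMA a:F. injective_words (F - {a}) i)"
      by (cases v) (auto simp: injective_words_def)
  qed (auto simp: injective_words_def)
  then have "card (injective_words F (Suc i)) = card (SIGMA a:F. injective_words (F - {a}) i)"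
    by (simp add: card_image inj_on_def)
  then show ?thesis using assms by (simp add: finite_injective_words)
qed

text \<open>A falling factorial; for i > card F the factor with j = card F is 0. What matters for
  the characters is that the count depends only on \<open>card F\<close>.\<close>

lemma card_injective_words:
  "finite F \<Longrightarrow> card (injective_words F i) = (\<Prod>j<i. card F - j)"
proof (induction i arbitrary: F)
  case (Suc i)
  have "(\<Sum>a\<in>F. card (injective_words (F - {a}) i)) = (\<Sum>a\<in>F. \<Prod>j<i. card F - Suc j)"
    using Suc by (intro sum.cong) auto
  then show ?case
    using Suc.prems by (simp add: card_injective_words_Suc prod.lessThan_Suc_shift del: prod.lessThan_Suc)
qed simp

definition weakly_increasing :: "int set \<Rightarrow> nat \<Rightarrow> int list set" where
  "weakly_increasing M i = {S. length S = i \<and> sorted S \<and> set S \<subseteq> M}"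

lemma weakly_increasing_0 [simp]: "weakly_increasing M 0 = {[]}"
  by (auto simp: weakly_increasing_def)

text \<open>Pascal's rule: either the first label is \<open>a\<close>, and a shorter sequence over
  the same labels follows, or all labels lie above \<open>a\<close>. Truncated subtraction also
  gives the right values for m = 0, namely 1 if i = 0 and 0 otherwise.\<close>

lemma card_weakly_increasing:
  "card (weakly_increasing {a..<a + int m} i) = (m + i - 1) choose i"
proof (induction "m + i" arbitrary: m i a)
  case 0
  then show ?case by simp
next
  case (Suc s)
  show ?case
  proof (cases i)
    case 0
    then show ?thesis by simp
  next
    case i: (Suc j)
    show ?thesis
    proof (cases m)
      case 0
      then have "weakly_increasing {a..<a + int m} i = {}"
        using i by (auto simp: weakly_increasing_def)
      then show ?thesis using 0 i by simp
    next
      case m: (Suc l)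
      let ?M = "{a..<a + int m}" and ?M' = "{a + 1..<(a + 1) + int l}"
      have fin: "finite (weakly_increasing M' j')" if "finite M'" for M' j'
        by (rule finite_subset[OF _ finite_lists_length_eq[OF that, of j']]) (auto simp: weakly_increasing_def)
      have "weakly_increasing ?M i = (#) a ` weakly_increasing ?M j \<union> weakly_increasing ?M' i"
      proof (intro equalityI subsetI)
        fix S assume S: "S \<in> weakly_increasing ?M i"
        then obtain b T where b: "S = b # T" using i by (cases S) (auto simp: weakly_increasing_def)
        show "S \<in> (#) a ` weakly_increasing ?M j \<union> weakly_increasing ?M' i"
        proof (cases "b = a")
          case True
          then show ?thesis using S b i by (auto simp: weakly_increasing_def)
        next
          case False
          have "a + 1 \<le> x" if "x \<in> set S" for x
          proof -
            have "a \<le> b" "b \<le> x" using S b that by (auto simp: weakly_increasing_def)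
            then show ?thesis using False by simp
          qed
          then have "S \<in> weakly_increasing ?M' i"
            using S m by (auto simp: weakly_increasing_def)
          then show ?thesis by simp
        qed
      next
        fix S assume "S \<in> (#) a ` weakly_increasing ?M j \<union> weakly_increasing ?M' i"
        then consider T where "S = a # T" "T \<in> weakly_increasing ?M j" | "S \<in> weakly_increasing ?M' i"
          by blast
        then show "S \<in> weakly_increasing ?M i"
        proof cases
          case (1 T)
          then have "set T \<subseteq> ?M" by (simp add: weakly_increasing_def)
          then have "\<forall>x\<in>set T. a \<le> x" by auto
          with 1 show ?thesis using i m by (simp add: weakly_increasing_def)
        next
          case 2
          have "?M' \<subseteq> ?M" using m by auto
          with 2 show ?thesis unfolding weakly_increasing_def by blast
        qed
      qed
      moreover have "(#) a ` weakly_increasing ?M j \<inter> weakly_increasing ?M' i = {}"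
        by (auto simp: weakly_increasing_def)
      ultimately have "card (weakly_increasing ?M i) =
          card ((#) a ` weakly_increasing ?M j) + card (weakly_increasing ?M' i)"
        using fin by (simp add: card_Un_disjoint)
      also have "card ((#) a ` weakly_increasing ?M j) = (m + j - 1) choose j"
        using Suc.hyps(1)[of m j a] Suc.hyps(2) i by (simp add: card_image)
      also have "card (weakly_increasing ?M' i) = (l + i - 1) choose i"
        using Suc.hyps(1)[of l i "a + 1"] Suc.hyps(2) m by simp
      finally show ?thesis using i m by simp
    qed
  qed
qed

section \<open>Signed sums of power sums\<close>

lemma mcoeff_simps [simp]:
  "mcoeff 0 m = 0" "mcoeff 1 m = (if m = 0 then 1 else 0)"
  "mcoeff (f + g) m = mcoeff f m + mcoeff g m" "mcoeff (mscale c f) m = c * mcoeff f m"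
  by (simp_all add: mfps_defs mscale_def)

lemma mcoeff_sum: "mcoeff (sum f A) m = (\<Sum>x\<in>A. mcoeff (f x) m)"
  by (induction A rule: infinite_finite_induct) simp_all

lemma mcoeff_mult: "mcoeff (f * g) m = (\<Sum>(a, b)\<in>msplits m. mcoeff f a * mcoeff g b)"
  by (simp add: times_mfps_def)

lemma mscale_mult_left: "mscale c f * g = mscale c (f * g)"
  by (rule mfps_eqI) (simp add: mcoeff_mult sum_distrib_left case_prod_unfold mult.assoc)

lemma mscale_mscale [simp]: "mscale a (mscale b f) = mscale (a * b) f"
  by (rule mfps_eqI) (simp add: mult.assoc)

lemma mscale_mult_right: "f * mscale c g = mscale c (f * g)"
  using mscale_mult_left[of c g f] by (simp add: mult.commute)

lemma mscale_1 [simp]: "mscale 1 f = f"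
  by (rule mfps_eqI) simp

lemma mscale_0 [simp]: "mscale 0 f = 0"
  by (rule mfps_eqI) simp

lemma mscale_sum_right: "mscale c (sum f A) = (\<Sum>x\<in>A. mscale c (f x))"
  by (rule mfps_eqI) (simp add: mcoeff_sum sum_distrib_left)

lemma mscale_sum_left: "mscale (sum c A) f = (\<Sum>x\<in>A. mscale (c x) f)"
  by (rule mfps_eqI) (simp add: mcoeff_sum sum_distrib_right)

text \<open>\<open>c_fun\<close> has its integer coefficients inside the ring of power series,
  \<open>frob_ch\<close> its coefficients as complex scalars; this lemma and the next translate
  between the two.\<close>

lemma mscale_of_nat: "mscale (of_nat n) f = of_nat n * f"
proof (induction n)
  case (Suc n)
  have "mscale (of_nat (Suc n)) f = mscale (of_nat n) f + f"
    by (rule mfps_eqI) (simp add: algebra_simps)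
  then show ?case using Suc by (simp add: algebra_simps)
qed simp

lemma mscale_minus1_power: "mscale ((-1) ^ n) f = (-1) ^ n * f"
proof (induction n)
  case (Suc n)
  have "mscale ((-1) ^ Suc n) f = - mscale ((-1) ^ n) f"
    by (rule mfps_eqI) (simp add: uminus_mfps_def)
  then show ?case using Suc by simp
qed simp

text \<open>The exponent vector of the monomial obtained by multiplying the variables with indices
  \<open>f x\<close>, for x in \<open>A\<close>.\<close>

definition content :: "'a set \<Rightarrow> ('a \<Rightarrow> nat) \<Rightarrow> (nat \<Rightarrow>\<^sub>0 nat)" where
  "content A f = (\<Sum>x\<in>A. Poly_Mapping.single (f x) 1)"

text \<open>The ways to pick one variable from each power sum of degree \<open>r C\<close> such that
  the chosen terms multiply to the monomial m.\<close>

definition weighted_maps :: "('b \<Rightarrow> nat) \<Rightarrow> 'b set \<Rightarrow> (nat \<Rightarrow>\<^sub>0 nat) \<Rightarrow> ('b \<Rightarrow> nat) set" where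
  "weighted_maps r P m = {g \<in> P \<rightarrow>\<^sub>E UNIV. (\<Sum>C\<in>P. Poly_Mapping.single (g C) (r C)) = m}"

text \<open>Expanding the product means picking a variable from each factor. Positive degrees
  matter: a term of a power sum of degree 0 would not remember its variable, and the set of choices
  could be infinite. Finiteness is carried along so that \<open>card\<close> is meaningful in the
  induction.\<close>

lemma mcoeff_prod_power_sum:
  fixes r :: "'b \<Rightarrow> nat"
  assumes "finite P" "\<And>C. C \<in> P \<Longrightarrow> 0 < r C"
  shows "finite (weighted_maps r P m) \<and>
    mcoeff (\<Prod>C\<in>P. power_sum (r C) :: 'c::comm_ring_1 mfps) m = of_nat (card (weighted_maps r P m))"
  using assms(1,2)
proof (induction P arbitrary: m rule: finite_induct)
  case empty
  have "weighted_maps r {} m = (if m = 0 then {\<lambda>_. undefined} else {})"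
    by (auto simp: weighted_maps_def)
  then show ?case by simp
next
  case (insert C P)
  let ?f = "\<lambda>g. (Poly_Mapping.single (g C) (r C), \<Sum>C\<in>P. Poly_Mapping.single (g C) (r C))"
  have r: "0 < r C" using insert.prems by simp
  \<comment> \<open>Over a splitting of m, the first part fixes the variable picked for
    \<open>C\<close>, and restriction to \<open>P\<close> leaves a choice for the second part.
    Summing over the splittings gives the product formula.\<close>
  have block: "finite {g \<in> weighted_maps r (insert C P) m. ?f g = p} \<and>
      (of_nat (card {g \<in> weighted_maps r (insert C P) m. ?f g = p}) :: 'c) =
      mcoeff (power_sum (r C)) (fst p) * mcoeff (\<Prod>C\<in>P. power_sum (r C)) (snd p)"
    if p: "p \<in> msplits m" for p
  proof (cases "\<exists>j. fst p = Poly_Mapping.single j (r C)")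
    case True
    then obtain j where j: "fst p = Poly_Mapping.single j (r C)" by blast
    have m: "Poly_Mapping.single j (r C) + snd p = m"
      using p j by (auto simp: msplits_def)
    have inj: "Poly_Mapping.single i (r C) = Poly_Mapping.single j (r C) \<longleftrightarrow> i = j" for i
      using r by (metis lookup_single_eq lookup_single_not_eq less_irrefl)
    have sum_upd: "(\<Sum>D\<in>P. Poly_Mapping.single ((h(C := j)) D) (r D)) =
        (\<Sum>D\<in>P. Poly_Mapping.single (h D) (r D))" for h
      using insert.hyps by (intro sum.cong) auto
    have sum_res: "(\<Sum>D\<in>P. Poly_Mapping.single ((restrict h P) D) (r D)) =
        (\<Sum>D\<in>P. Poly_Mapping.single (h D) (r D))" for h
      by (intro sum.cong) auto
    have "bij_betw (\<lambda>g. restrict g P) {g \<in> weighted_maps r (insert C P) m. ?f g = p} (weighted_maps r P (snd p))"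
    proof (rule bij_betw_byWitness[where f' = "\<lambda>h. h(C := j)"])
      show "\<forall>g\<in>{g \<in> weighted_maps r (insert C P) m. ?f g = p}. (restrict g P)(C := j) = g"
        using j inj by (auto simp: weighted_maps_def fun_eq_iff PiE_def extensional_def)
      show "\<forall>h\<in>weighted_maps r P (snd p). restrict (h(C := j)) P = h"
        using insert.hyps by (auto simp: weighted_maps_def fun_eq_iff PiE_def extensional_def)
      show "(\<lambda>g. restrict g P) ` {g \<in> weighted_maps r (insert C P) m. ?f g = p} \<subseteq> weighted_maps r P (snd p)"
        using sum_res by (auto simp: weighted_maps_def)
      show "(\<lambda>h. h(C := j)) ` weighted_maps r P (snd p) \<subseteq> {g \<in> weighted_maps r (insert C P) m. ?f g = p}"
      proof (rule image_subsetI)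
        fix h assume h: "h \<in> weighted_maps r P (snd p)"
        have "h(C := j) \<in> insert C P \<rightarrow>\<^sub>E UNIV"
          using h by (auto simp: weighted_maps_def PiE_def extensional_def)
        moreover have s: "(\<Sum>D\<in>P. Poly_Mapping.single ((h(C := j)) D) (r D)) = snd p"
          using h by (simp only: sum_upd) (simp add: weighted_maps_def)
        moreover have "(\<Sum>D\<in>insert C P. Poly_Mapping.single ((h(C := j)) D) (r D)) = m"
          using insert.hyps s m by simp
        ultimately show "h(C := j) \<in> {g \<in> weighted_maps r (insert C P) m. ?f g = p}"
          using j by (simp add: weighted_maps_def prod_eq_iff)
      qed
    qed
    then have "finite {g \<in> weighted_maps r (insert C P) m. ?f g = p} \<longleftrightarrow> finite (weighted_maps r P (snd p))"
      "card {g \<in> weighted_maps r (insert C P) m. ?f g = p} = card (weighted_maps r P (snd p))"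
      by (auto dest: bij_betw_finite bij_betw_same_card)
    then show ?thesis
      using insert.IH[of "snd p"] insert.prems j by (auto simp: power_sum_def)
  next
    case False
    then have e: "{g \<in> weighted_maps r (insert C P) m. ?f g = p} = {}" by auto
    show ?thesis unfolding e using False by (simp add: power_sum_def)
  qed
  have maps: "?f ` weighted_maps r (insert C P) m \<subseteq> msplits m"
    using insert.hyps by (auto simp: weighted_maps_def msplits_def)
  then have "weighted_maps r (insert C P) m = (\<Union>p\<in>msplits m. {g \<in> weighted_maps r (insert C P) m. ?f g = p})"
    by blast
  also have "finite \<dots>" using block by (intro finite_UN_I) auto
  finally have fin: "finite (weighted_maps r (insert C P) m)" .
  have "(of_nat (card (weighted_maps r (insert C P) m)) :: 'c) =
      (\<Sum>p\<in>msplits m. of_nat (card {g \<in> weighted_maps r (insert C P) m. ?f g = p}))"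
    using sum.group[OF fin finite_msplits maps, of "\<lambda>_. 1 :: 'c"] by simp
  also have "\<dots> = (\<Sum>p\<in>msplits m. mcoeff (power_sum (r C)) (fst p) * mcoeff (\<Prod>C\<in>P. power_sum (r C)) (snd p))"
    using block by (intro sum.cong) auto
  also have "\<dots> = mcoeff (\<Prod>C\<in>insert C P. power_sum (r C)) m"
    using insert.hyps by (simp add: mcoeff_mult case_prod_unfold)
  finally show ?case using fin by simp
qed

text \<open>The power sum product of the cycle type, indexed by the cycles themselves. Cycles of
  equal length remain distinct factors, and single cycles can be split off.\<close>

definition cycle_power_sum :: "'a set \<Rightarrow> ('a \<Rightarrow> 'a) \<Rightarrow> 'c::comm_ring_1 mfps" where
  "cycle_power_sum A \<sigma> = (\<Prod>C\<in>orbit \<sigma> ` A. power_sum (card C))"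

lemma power_sums_cycle_type: "power_sums (cycle_type A \<sigma>) = cycle_power_sum A \<sigma>"
proof -
  have "power_sums (cycle_type A \<sigma>) = prod_mset (image_mset power_sum (mset (cycle_type A \<sigma>)))"
    by (simp add: power_sums_def prod_mset_prod_list[symmetric])
  also have "\<dots> = cycle_power_sum A \<sigma>"
    by (simp add: mset_cycle_type cycle_power_sum_def prod_unfold_prod_mset image_mset.compositionality comp_def)
  finally show ?thesis .
qed

lemma sum_single_const: "finite C \<Longrightarrow> (\<Sum>x\<in>C. Poly_Mapping.single j (1::nat)) = Poly_Mapping.single j (card C)"
  by (induction C rule: finite_induct) (simp_all add: single_add[symmetric])

lemma content_orbit_map:
  assumes \<sigma>: "\<sigma> permutes A" "finite A"
  shows "content A (\<lambda>x\<in>A. g (orbit \<sigma> x)) = (\<Sum>C\<in>orbit \<sigma> ` A. Poly_Mapping.single (g C) (card C))"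
proof -
  have "content A (\<lambda>x\<in>A. g (orbit \<sigma> x)) =
      (\<Sum>C\<in>orbit \<sigma> ` A. \<Sum>x\<in>{x \<in> A. orbit \<sigma> x = C}. Poly_Mapping.single (g (orbit \<sigma> x)) 1)"
    unfolding content_def using \<sigma>(2) by (subst sum.group) auto
  also have "\<dots> = (\<Sum>C\<in>orbit \<sigma> ` A. Poly_Mapping.single (g C) (card C))"
  proof (rule sum.cong[OF refl])
    fix C assume "C \<in> orbit \<sigma> ` A"
    then obtain y where y: "y \<in> A" "C = orbit \<sigma> y" by blast
    have "{x \<in> A. orbit \<sigma> x = C} = C"
      using y orbit_facts(1,2,4)[OF \<sigma>] by blast
    moreover have "finite C" using y orbit_facts(3)[OF \<sigma>] by simp
    moreover have "(\<Sum>x\<in>{x \<in> A. orbit \<sigma> x = C}. Poly_Mapping.single (g (orbit \<sigma> x)) (1::nat)) =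
        (\<Sum>x\<in>{x \<in> A. orbit \<sigma> x = C}. Poly_Mapping.single (g C) 1)"
      by (intro sum.cong) auto
    ultimately show "(\<Sum>x\<in>{x \<in> A. orbit \<sigma> x = C}. Poly_Mapping.single (g (orbit \<sigma> x)) 1) =
        Poly_Mapping.single (g C) (card C)"
      using sum_single_const by metis
  qed
  finally show ?thesis .
qed

text \<open>Picking a variable for each cycle is the same as labelling the points by a map constant
  on cycles; a cycle then contributes its variable as often as it has points.\<close>

lemma mcoeff_cycle_power_sum:
  assumes \<sigma>: "\<sigma> permutes A" "finite A"
  shows "mcoeff (cycle_power_sum A \<sigma> :: 'c::comm_ring_1 mfps) m =
    of_nat (card {f \<in> invariant_maps A \<sigma> UNIV. content A f = m})"
proof -
  let ?T = "weighted_maps card (orbit \<sigma> ` A) m"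
  let ?\<Phi> = "\<lambda>g. \<lambda>x\<in>A. g (orbit \<sigma> x)"
  have pos: "0 < card C" if "C \<in> orbit \<sigma> ` A" for C
    using that orbit_facts(1,3)[OF \<sigma>] by (auto simp: card_gt_0_iff)
  have bij: "bij_betw ?\<Phi> ((orbit \<sigma> ` A) \<rightarrow>\<^sub>E UNIV) (invariant_maps A \<sigma> (UNIV :: nat set))"
    by (rule bij_betw_invariant_maps[OF \<sigma>])
  have "bij_betw ?\<Phi> ?T (?\<Phi> ` ?T)"
    by (rule bij_betw_subset[OF bij]) (auto simp: weighted_maps_def)
  moreover have "?\<Phi> ` ?T = {f \<in> invariant_maps A \<sigma> UNIV. content A f = m}"
    unfolding bij_betw_imp_surj_on[OF bij, symmetric] using content_orbit_map[OF \<sigma>] by (auto simp: weighted_maps_def)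
  ultimately have "card ?T = card {f \<in> invariant_maps A \<sigma> UNIV. content A f = m}"
    using bij_betw_same_card by fastforce
  then show ?thesis
    using mcoeff_prod_power_sum[of "orbit \<sigma> ` A" card m, where 'c = 'c] pos \<sigma>(2)
    by (simp add: cycle_power_sum_def)
qed

lemma lookup_content: "finite A \<Longrightarrow> Poly_Mapping.lookup (content A f) i = card {x \<in> A. f x = i}"
  by (simp add: content_def lookup_sum lookup_single when_def sum.If_cases Int_def)

lemma sum_sign_stabilizer:
  assumes A: "finite A"
  shows "(\<Sum>\<sigma> | \<sigma> permutes A \<and> (\<forall>x\<in>A. f (\<sigma> x) = f x). of_int (sign \<sigma>) :: complex) =
    (if inj_on f A then 1 else 0)"
proof (cases "inj_on f A")
  case True
  have "{\<sigma>. \<sigma> permutes A \<and> (\<forall>x\<in>A. f (\<sigma> x) = f x)} = {id}"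
  proof (intro equalityI subsetI)
    fix \<sigma> assume \<sigma>: "\<sigma> \<in> {\<sigma>. \<sigma> permutes A \<and> (\<forall>x\<in>A. f (\<sigma> x) = f x)}"
    have "\<sigma> x = x" for x
    proof (cases "x \<in> A")
      case x: True
      then have "\<sigma> x \<in> A" using \<sigma> permutes_in_image by fastforce
      then show ?thesis using inj_onD[OF True, of "\<sigma> x" x] \<sigma> x by simp
    next
      case False
      then show ?thesis using \<sigma> by (auto simp: permutes_def)
    qed
    then show "\<sigma> \<in> {id}" by auto
  qed (auto simp: permutes_id)
  then show ?thesis using True by (simp add: sign_id)
next
  case False
  then obtain a b where ab: "a \<in> A" "b \<in> A" "a \<noteq> b" "f a = f b"
    by (auto simp: inj_on_def)
  let ?t = "Transposition.transpose a b"
  let ?S = "{\<sigma>. \<sigma> permutes A \<and> (\<forall>x\<in>A. f (\<sigma> x) = f x)}"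
  \<comment> \<open>Since f does not see the transposition, composing with it on the left preserves
    the condition that f is invariant.\<close>
  have ft: "f (?t y) = f y" for y
    using ab(4) by (auto simp: Transposition.transpose_def)
  have t: "?t permutes A" using ab by (intro permutes_swap_id)
  have mem: "?t \<circ> \<sigma> \<in> ?S" if "\<sigma> \<in> ?S" for \<sigma>
    using that ft permutes_compose[OF _ t] by auto
  have "(\<Sum>\<sigma>\<in>?S. of_int (sign \<sigma>) :: complex) = (\<Sum>\<sigma>\<in>?S. - of_int (sign \<sigma>))"
  proof (rule sum.reindex_bij_witness[of _ "\<lambda>\<sigma>. ?t \<circ> \<sigma>" "\<lambda>\<sigma>. ?t \<circ> \<sigma>"])
    fix \<sigma> assume \<sigma>: "\<sigma> \<in> ?S"
    show "?t \<circ> (?t \<circ> \<sigma>) = \<sigma>" by (simp add: fun_eq_iff)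
    show "?t \<circ> \<sigma> \<in> ?S" by (rule mem[OF \<sigma>])
    then show "?t \<circ> \<sigma> \<in> ?S" .
    have "permutation ?t" "permutation \<sigma>"
      using t \<sigma> A permutation_permutes by blast+
    then have "sign (?t \<circ> \<sigma>) = - sign \<sigma>"
      using ab(3) by (simp add: sign_compose sign_swap_id)
    then show "- of_int (sign (?t \<circ> \<sigma>)) = (of_int (sign \<sigma>) :: complex)" by simp
  qed (simp_all add: fun_eq_iff mem)
  then have "(\<Sum>\<sigma>\<in>?S. of_int (sign \<sigma>) :: complex) = 0"
    by (simp add: sum_negf)
  then show ?thesis using False by simp
qed

section \<open>One-column Schur functions and squarefree monomials\<close>

lemma diagram_column: "diagram (replicate j (Suc 0)) = {..<j} \<times> {0}"
  by (auto simp: diagram_def)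

lemma sorted_wrt_less_map_upt:
  "(\<forall>r. Suc r < j \<longrightarrow> t r < t (Suc r)) \<Longrightarrow> sorted_wrt (<) (map t [0..<j])" for t :: "nat \<Rightarrow> nat"
  by (subst sorted_wrt_iff_nth_Suc_transp) auto

text \<open>A one-column semistandard filling lists its entries in strictly increasing order, so it
  is determined by its set of entries. This identifies the Schur function with the elementary
  symmetric function of degree j.\<close>

lemma mcoeff_schur_column:
  "mcoeff (schur (replicate j 1) :: 'c::comm_ring_1 mfps) m =
    (if (\<forall>i. Poly_Mapping.lookup m i \<le> 1) \<and> card (Poly_Mapping.keys m) = j then 1 else 0)"
proof -
  let ?D = "{..<j} \<times> {0::nat}"
  let ?K = "Poly_Mapping.keys m"
  let ?X = "{T \<in> ssyt (replicate j (Suc 0)). \<forall>i. card {u \<in> ?D. T u = i} = Poly_Mapping.lookup m i}"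
  \<comment> \<open>The only candidate: the support of m, read down the column in increasing
    order.\<close>
  define T0 where "T0 = (\<lambda>u\<in>?D. sorted_list_of_set ?K ! fst u)"
  have ssyt: "T \<in> ssyt (replicate j (Suc 0)) \<longleftrightarrow>
      T \<in> extensional ?D \<and> (\<forall>r. Suc r < j \<longrightarrow> T (r, 0) < T (Suc r, 0))" for T
    by (auto simp: ssyt_def diagram_column)
  have cardD: "card {u \<in> ?D. T u = i} = card {r \<in> {..<j}. T (r, 0) = i}" for T i
  proof -
    have "{u \<in> ?D. T u = i} = (\<lambda>r. (r, 0)) ` {r \<in> {..<j}. T (r, 0) = i}" by auto
    then show ?thesis by (simp add: card_image inj_on_def)
  qed
  have X: "(\<forall>i. Poly_Mapping.lookup m i \<le> 1) \<and> card ?K = j \<and> T = T0" if T: "T \<in> ?X" for T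
  proof -
    define t where "t r = T (r, 0)" for r
    have l: "Poly_Mapping.lookup m i = card {r \<in> {..<j}. t r = i}" for i
      using T cardD[of T i] by (simp add: t_def)
    have s: "sorted_wrt (<) (map t [0..<j])"
      using T ssyt[of T] by (intro sorted_wrt_less_map_upt) (simp add: t_def)
    then have "distinct (map t [0..<j])" using strict_sorted_iff by blast
    then have inj: "inj_on t {..<j}" by (simp add: distinct_map atLeast_upt)
    have K: "?K = t ` {..<j}"
      by (auto simp: in_keys_iff l card_gt_0_iff neq0_conv)
    have "card {r \<in> {..<j}. t r = i} \<le> 1" for i
      using inj by (intro card_le_Suc0_iff_eq[THEN iffD2, simplified One_nat_def[symmetric]]) (auto simp: inj_on_def)
    moreover have "card ?K = j" using K inj by (simp add: card_image)
    moreover have "T = T0"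
    proof (rule extensionalityI[of _ ?D])
      show "T \<in> extensional ?D" using T ssyt by auto
      show "T0 \<in> extensional ?D" by (simp add: T0_def)
      have "map t [0..<j] = sorted_list_of_set ?K"
        using s by (intro strict_sorted_equal) (auto simp: K)
      then show "T u = T0 u" if "u \<in> ?D" for u
        using that nth_map[of "fst u" "[0..<j]" t] by (auto simp: T0_def t_def)
    qed
    ultimately show ?thesis using l by simp
  qed
  have T0: "T0 \<in> ?X" if m: "\<forall>i. Poly_Mapping.lookup m i \<le> 1" "card ?K = j"
  proof -
    have st: "sorted_wrt (<) (sorted_list_of_set ?K)" "length (sorted_list_of_set ?K) = j"
      using m by simp_all
    have "T0 \<in> ssyt (replicate j (Suc 0))"
      unfolding ssyt using st sorted_wrt_nth_less[OF st(1)] by (auto simp: T0_def)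
    moreover have "card {u \<in> ?D. T0 u = i} = Poly_Mapping.lookup m i" for i
    proof -
      have eq: "{r \<in> {..<j}. T0 (r, 0) = i} = {r. r < length (sorted_list_of_set ?K) \<and> sorted_list_of_set ?K ! r = i}"
        using st(2) by (auto simp: T0_def)
      show ?thesis
      proof (cases "i \<in> ?K")
        case True
        then obtain r where r: "r < j" "sorted_list_of_set ?K ! r = i"
          using st(2) by (metis finite_keys in_set_conv_nth set_sorted_list_of_set)
        then have "{r \<in> {..<j}. T0 (r, 0) = i} = {r}"
          unfolding eq using st(2) nth_eq_iff_index_eq[of "sorted_list_of_set ?K"] by auto
        moreover have "Poly_Mapping.lookup m i = 1"
          using True m(1)[rule_format, of i] by (simp add: in_keys_iff)
        ultimately show ?thesis by (simp add: cardD)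
      next
        case False
        then have "{r \<in> {..<j}. T0 (r, 0) = i} = {}"
          unfolding eq using nth_mem[of _ "sorted_list_of_set ?K"] by auto
        then show ?thesis using False by (simp add: cardD in_keys_iff)
      qed
    qed
    ultimately show ?thesis by simp
  qed
  have "?X = (if (\<forall>i. Poly_Mapping.lookup m i \<le> 1) \<and> card ?K = j then {T0} else {})"
  proof (cases "(\<forall>i. Poly_Mapping.lookup m i \<le> 1) \<and> card ?K = j")
    case True
    then have "T0 \<in> ?X" using T0 by blast
    then have "?X = {T0}" using X by blast
    then show ?thesis using True by simp
  next
    case False
    then have "?X = {}" using X by blast
    then show ?thesis unfolding if_not_P[OF False] .
  qed
  then show ?thesis by (simp add: schur_def diagram_column)
qed

lemma schur_single_box: "schur [1] = power_sum 1"
proof (rule mfps_eqI)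
  fix m :: "nat \<Rightarrow>\<^sub>0 nat"
  have "(\<forall>i. Poly_Mapping.lookup m i \<le> 1) \<and> card (Poly_Mapping.keys m) = 1 \<longleftrightarrow>
      (\<exists>i. m = Poly_Mapping.single i 1)"
  proof
    assume m: "(\<forall>i. Poly_Mapping.lookup m i \<le> 1) \<and> card (Poly_Mapping.keys m) = 1"
    then obtain i where i: "Poly_Mapping.keys m = {i}" by (auto simp: card_1_singleton_iff)
    have "m = Poly_Mapping.single i 1"
    proof (rule poly_mapping_eqI)
      fix j
      show "Poly_Mapping.lookup m j = Poly_Mapping.lookup (Poly_Mapping.single i 1) j"
      proof (cases "j = i")
        case True
        then have "j \<in> Poly_Mapping.keys m" using i by simp
        then have "Poly_Mapping.lookup m j \<noteq> 0" by (simp add: in_keys_iff)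
        then have "Poly_Mapping.lookup m j = 1" using m[THEN conjunct1, rule_format, of j] by linarith
        then show ?thesis using True by simp
      next
        case False
        then have "j \<notin> Poly_Mapping.keys m" using i by simp
        then show ?thesis using False by (simp add: in_keys_iff lookup_single when_def)
      qed
    qed
    then show "\<exists>i. m = Poly_Mapping.single i 1" ..
  qed (auto simp: lookup_single when_def)
  then show "mcoeff (schur [1]) m = mcoeff (power_sum 1) m"
    using mcoeff_schur_column[of 1 m] by (simp add: power_sum_def)
qed

text \<open>An injective map has squarefree content with support its image. Conversely, an injective
  map into a set of the same size is onto, so the maps counted are the bijections from
  \<open>A\<close> to the support of m.\<close>

lemma card_injective_content:
  assumes A: "finite A"
  shows "card {f \<in> A \<rightarrow>\<^sub>E UNIV. content A f = m \<and> inj_on f A} =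
    (if (\<forall>i. Poly_Mapping.lookup m i \<le> 1) \<and> card (Poly_Mapping.keys m) = card A then fact (card A) else 0)"
proof -
  let ?K = "Poly_Mapping.keys m"
  let ?X = "{f \<in> A \<rightarrow>\<^sub>E UNIV. content A f = m \<and> inj_on f A}"
  have lookup_inj: "Poly_Mapping.lookup (content A f) i = (if i \<in> f ` A then 1 else 0)"
    if "inj_on f A" for f i
  proof (cases "i \<in> f ` A")
    case True
    then obtain x where "x \<in> A" "i = f x" by blast
    then have "{y \<in> A. f y = i} = {x}" using that by (auto simp: inj_on_def)
    then show ?thesis using True A by (simp add: lookup_content)
  next
    case False
    then have "{y \<in> A. f y = i} = {}" by blast
    then show ?thesis using False A by (simp add: lookup_content)
  qed
  have X: "(\<forall>i. Poly_Mapping.lookup m i \<le> 1) \<and> ?K = f ` A" if "f \<in> ?X" for f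
    using that lookup_inj[of f] by (auto simp: in_keys_iff split: if_splits)
  show ?thesis
  proof (cases "(\<forall>i. Poly_Mapping.lookup m i \<le> 1) \<and> card ?K = card A")
    case True
    have "?X = {f \<in> A \<rightarrow>\<^sub>E ?K. inj_on f A}"
    proof (intro equalityI subsetI)
      fix f assume "f \<in> ?X"
      then show "f \<in> {f \<in> A \<rightarrow>\<^sub>E ?K. inj_on f A}" using X[of f] by auto
    next
      fix f assume f: "f \<in> {f \<in> A \<rightarrow>\<^sub>E ?K. inj_on f A}"
      then have fA: "f ` A = ?K"
        using True by (intro card_subset_eq) (auto simp: card_image)
      have "content A f = m"
      proof (rule poly_mapping_eqI)
        fix i
        have "Poly_Mapping.lookup m i = (if i \<in> ?K then 1 else 0)"
          using True[THEN conjunct1, rule_format, of i] by (auto simp: in_keys_iff)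
        then show "Poly_Mapping.lookup (content A f) i = Poly_Mapping.lookup m i"
          using f lookup_inj[of f i] fA by simp
      qed
      then show "f \<in> ?X" using f by auto
    qed
    then show ?thesis
      using True card_inj_on_subset_funcset[OF A finite_keys subset_refl, of m]
      by (simp add: fact_prod_rev)
  next
    case False
    have e: "?X = {}"
    proof (rule ccontr)
      assume "?X \<noteq> {}"
      then obtain f where f: "f \<in> ?X" by blast
      then have "card ?K = card A" using X[OF f] by (simp add: card_image)
      then show False using False X[OF f] by blast
    qed
    show ?thesis unfolding e if_not_P[OF False] by simp
  qed
qed

lemma signed_sum_cycle_power_sum:
  assumes A: "finite A"
  shows "(\<Sum>\<sigma> | \<sigma> permutes A. mscale (of_int (sign \<sigma>)) (cycle_power_sum A \<sigma>)) =
    mscale (fact (card A)) (schur (replicate (card A) 1) :: complex mfps)"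
proof (rule mfps_eqI)
  fix m
  define E where "E = {f \<in> A \<rightarrow>\<^sub>E UNIV. content A f = m}"
  \<comment> \<open>Every value taken by f occurs in its content, so all values lie in the support
    of m. This makes \<open>E\<close> finite, as the exchange of sums requires.\<close>
  have "E \<subseteq> A \<rightarrow>\<^sub>E Poly_Mapping.keys m"
  proof
    fix f assume f: "f \<in> E"
    have "f x \<in> Poly_Mapping.keys m" if "x \<in> A" for x
    proof -
      have "Poly_Mapping.lookup m (f x) = card {y \<in> A. f y = f x}"
        using f lookup_content[OF A, of f] by (simp add: E_def)
      also have "\<dots> \<noteq> 0" using A that by auto
      finally show ?thesis by (simp add: in_keys_iff)
    qed
    then show "f \<in> A \<rightarrow>\<^sub>E Poly_Mapping.keys m" using f by (auto simp: E_def)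
  qed
  then have finE: "finite E" by (rule finite_subset) (simp add: A finite_PiE)
  have finP: "finite {\<sigma>. \<sigma> permutes A}" using A by (rule finite_permutations)
  have "mcoeff (\<Sum>\<sigma> | \<sigma> permutes A. mscale (of_int (sign \<sigma>)) (cycle_power_sum A \<sigma>)) m =
      (\<Sum>\<sigma> | \<sigma> permutes A. \<Sum>f\<in>E. if \<forall>x\<in>A. f (\<sigma> x) = f x then of_int (sign \<sigma>) else 0 :: complex)"
    unfolding mcoeff_sum
  proof (rule sum.cong[OF refl])
    fix \<sigma> assume "\<sigma> \<in> {\<sigma>. \<sigma> permutes A}"
    then have \<sigma>: "\<sigma> permutes A" by simp
    have "{f \<in> invariant_maps A \<sigma> UNIV. content A f = m} = {f \<in> E. \<forall>x\<in>A. f (\<sigma> x) = f x}"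
      by (auto simp: E_def invariant_maps_def)
    then show "mcoeff (mscale (of_int (sign \<sigma>)) (cycle_power_sum A \<sigma>)) m =
        (\<Sum>f\<in>E. if \<forall>x\<in>A. f (\<sigma> x) = f x then of_int (sign \<sigma>) else 0 :: complex)"
      using finE by (simp add: mcoeff_cycle_power_sum[OF \<sigma> A] sum.If_cases Int_def mult.commute)
  qed
  also have "\<dots> = (\<Sum>f\<in>E. \<Sum>\<sigma> | \<sigma> permutes A \<and> (\<forall>x\<in>A. f (\<sigma> x) = f x). of_int (sign \<sigma>))"
    using finP by (subst sum.swap) (simp add: sum.inter_filter[symmetric])
  also have "\<dots> = (\<Sum>f\<in>E. if inj_on f A then 1 else 0)"
    by (simp only: sum_sign_stabilizer[OF A])
  also have "\<dots> = of_nat (card {f \<in> E. inj_on f A})"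
    using finE by (simp add: sum.If_cases Int_def)
  also have "{f \<in> E. inj_on f A} = {f \<in> A \<rightarrow>\<^sub>E UNIV. content A f = m \<and> inj_on f A}"
    by (auto simp: E_def)
  finally show "mcoeff (\<Sum>\<sigma> | \<sigma> permutes A. mscale (of_int (sign \<sigma>) :: complex) (cycle_power_sum A \<sigma>)) m =
      mcoeff (mscale (fact (card A)) (schur (replicate (card A) 1))) m"
    using mcoeff_schur_column[of "card A" m, where 'c = complex] by (simp add: card_injective_content[OF A])
qed

lemma cycle_power_sum_fixed_point:
  assumes "\<sigma> permutes A" "finite A" "\<sigma> a = a" "a \<in> A"
  shows "cycle_power_sum A \<sigma> = power_sum 1 * cycle_power_sum (A - {a}) \<sigma>"
  unfolding cycle_power_sum_def orbit_image_fixed_point(1)[OF assms]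
  using orbit_image_fixed_point(2)[OF assms] assms(2) by (subst prod.insert) auto

text \<open>\<open>A\<close> is generalised because the first letter a is removed from it. Pairs of
  a permutation and a fixed point a are regrouped by a; the permutations fixing a are those of
  \<open>A - {a}\<close>, with the same sign. All letters contribute equally, and
  \<open>card A\<close> copies of \<open>(card A - 1)!\<close> make \<open>card A!\<close>.\<close>

lemma signed_sum_injective_words:
  "finite A \<Longrightarrow> i \<le> card A \<Longrightarrow>
    (\<Sum>\<sigma> | \<sigma> permutes A. mscale (of_int (sign \<sigma>) * of_nat (card (injective_words (fixed_points A \<sigma>) i)))
      (cycle_power_sum A \<sigma>)) =
    mscale (fact (card A)) (schur (replicate (card A - i) 1) * schur [1] ^ i :: complex mfps)"
proof (induction i arbitrary: A)
  case 0
  then show ?case using signed_sum_cycle_power_sum[OF 0(1)] by simp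
next
  case (Suc i)
  let ?s = "\<lambda>\<sigma>. of_int (sign \<sigma>) :: complex"
  let ?N = "\<lambda>A \<sigma>. of_nat (card (injective_words (fixed_points A \<sigma>) i)) :: complex"
  have "(\<Sum>\<sigma> | \<sigma> permutes A. mscale (?s \<sigma> * of_nat (card (injective_words (fixed_points A \<sigma>) (Suc i))))
      (cycle_power_sum A \<sigma>)) =
    (\<Sum>\<sigma> | \<sigma> permutes A. \<Sum>a\<in>A. if \<sigma> a = a then
      mscale (?s \<sigma> * ?N (A - {a}) \<sigma>) (power_sum 1 * cycle_power_sum (A - {a}) \<sigma>) else 0)"
  proof (rule sum.cong[OF refl])
    fix \<sigma> assume "\<sigma> \<in> {\<sigma>. \<sigma> permutes A}"
    then have \<sigma>: "\<sigma> permutes A" by simp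
    have fin: "finite (fixed_points A \<sigma>)" using Suc.prems by (simp add: fixed_points_def)
    have "fixed_points A \<sigma> - {a} = fixed_points (A - {a}) \<sigma>" for a
      by (auto simp: fixed_points_def)
    then have "mscale (?s \<sigma> * of_nat (card (injective_words (fixed_points A \<sigma>) (Suc i)))) (cycle_power_sum A \<sigma>) =
        (\<Sum>a\<in>fixed_points A \<sigma>. mscale (?s \<sigma> * ?N (A - {a}) \<sigma>) (cycle_power_sum A \<sigma>))"
      by (simp add: card_injective_words_Suc[OF fin] sum_distrib_left mscale_sum_left)
    also have "\<dots> = (\<Sum>a\<in>fixed_points A \<sigma>. mscale (?s \<sigma> * ?N (A - {a}) \<sigma>)
        (power_sum 1 * cycle_power_sum (A - {a}) \<sigma>))"
    proof (rule sum.cong[OF refl])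
      fix a assume "a \<in> fixed_points A \<sigma>"
      then have "\<sigma> a = a" "a \<in> A" by (auto simp: fixed_points_def)
      then show "mscale (?s \<sigma> * ?N (A - {a}) \<sigma>) (cycle_power_sum A \<sigma>) =
          mscale (?s \<sigma> * ?N (A - {a}) \<sigma>) (power_sum 1 * cycle_power_sum (A - {a}) \<sigma>)"
        using cycle_power_sum_fixed_point[OF \<sigma> Suc.prems(1)] by metis
    qed
    also have "\<dots> = (\<Sum>a\<in>A. if \<sigma> a = a then
        mscale (?s \<sigma> * ?N (A - {a}) \<sigma>) (power_sum 1 * cycle_power_sum (A - {a}) \<sigma>) else 0)"
      unfolding fixed_points_def[of A] by (rule sum.inter_filter[OF Suc.prems(1)])
    finally show "mscale (?s \<sigma> * of_nat (card (injective_words (fixed_points A \<sigma>) (Suc i)))) (cycle_power_sum A \<sigma>) =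
      (\<Sum>a\<in>A. if \<sigma> a = a then
        mscale (?s \<sigma> * ?N (A - {a}) \<sigma>) (power_sum 1 * cycle_power_sum (A - {a}) \<sigma>) else 0)" .
  qed
  also have "\<dots> = (\<Sum>a\<in>A. \<Sum>\<sigma> | \<sigma> permutes A \<and> \<sigma> a = a.
      mscale (?s \<sigma> * ?N (A - {a}) \<sigma>) (power_sum 1 * cycle_power_sum (A - {a}) \<sigma>))"
    using finite_permutations[OF Suc.prems(1)] by (subst sum.swap) (simp add: sum.inter_filter[symmetric])
  also have "\<dots> = (\<Sum>a\<in>A. power_sum 1 * (\<Sum>\<sigma> | \<sigma> permutes (A - {a}).
      mscale (?s \<sigma> * ?N (A - {a}) \<sigma>) (cycle_power_sum (A - {a}) \<sigma>)))"
  proof (rule sum.cong[OF refl])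
    fix a assume a: "a \<in> A"
    have "\<sigma> permutes A \<and> \<sigma> a = a \<longleftrightarrow> \<sigma> permutes (A - {a})" for \<sigma>
    proof (intro iffI conjI)
      show "\<sigma> permutes (A - {a})" if "\<sigma> permutes A \<and> \<sigma> a = a"
        using that permutes_remove_fixed_point by metis
      show "\<sigma> permutes A" if "\<sigma> permutes (A - {a})"
        by (rule permutes_subset[OF that]) auto
      show "\<sigma> a = a" if "\<sigma> permutes (A - {a})"
        by (rule permutes_not_in[OF that]) simp
    qed
    then show "(\<Sum>\<sigma> | \<sigma> permutes A \<and> \<sigma> a = a.
        mscale (?s \<sigma> * ?N (A - {a}) \<sigma>) (power_sum 1 * cycle_power_sum (A - {a}) \<sigma>)) =
      power_sum 1 * (\<Sum>\<sigma> | \<sigma> permutes (A - {a}).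
        mscale (?s \<sigma> * ?N (A - {a}) \<sigma>) (cycle_power_sum (A - {a}) \<sigma>))"
      by (simp add: sum_distrib_left mscale_mult_right)
  qed
  also have "\<dots> = (\<Sum>a\<in>A. power_sum 1 * mscale (fact (card A - 1))
      (schur (replicate (card A - Suc i) 1) * schur [1] ^ i))"
  proof (rule sum.cong[OF refl])
    fix a assume a: "a \<in> A"
    have "card (A - {a}) = card A - 1" using a Suc.prems by simp
    then show "power_sum 1 * (\<Sum>\<sigma> | \<sigma> permutes (A - {a}).
        mscale (?s \<sigma> * ?N (A - {a}) \<sigma>) (cycle_power_sum (A - {a}) \<sigma>)) =
      power_sum 1 * mscale (fact (card A - 1)) (schur (replicate (card A - Suc i) 1) * schur [1] ^ i)"
      using Suc.IH[of "A - {a}"] Suc.prems by simp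
  qed
  also have "\<dots> = mscale (fact (card A)) (schur (replicate (card A - Suc i) 1) * schur [1] ^ Suc i)"
  proof -
    let ?S = "schur (replicate (card A - Suc i) 1) :: complex mfps"
    have f: "(fact (card A - 1) :: complex) * of_nat (card A) = fact (card A)"
      using Suc.prems by (subst mult.commute, intro fact_reduce[symmetric]) simp
    have "power_sum 1 * (?S * schur [1] ^ i) = ?S * schur [1] ^ Suc i"
      by (simp only: schur_single_box power_Suc mult.left_commute)
    then show ?thesis
      by (simp only: sum_constant mscale_mult_right mscale_of_nat[symmetric] mscale_mscale f)
  qed
  finally show ?case .
qed

section \<open>Frobenius characteristics\<close>

text \<open>Ensures that grouping the permutations by the elements of
  \<open>partitions (card A)\<close> misses none of them.\<close>

lemma cycle_type_partitions:
  assumes "finite A" "\<sigma> permutes A"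
  shows "cycle_type A \<sigma> \<in> partitions (card A)"
proof -
  have "sorted_wrt (\<ge>) (cycle_type A \<sigma>)"
    unfolding cycle_type_def sorted_wrt_rev by simp
  moreover have "0 \<notin> set (cycle_type A \<sigma>)"
  proof -
    have "set (cycle_type A \<sigma>) = set_mset (mset (cycle_type A \<sigma>))" by simp
    also have "\<dots> = card ` orbit \<sigma> ` A"
      unfolding mset_cycle_type using assms(1) by simp
    finally show ?thesis
      using orbit_facts(1,3)[OF assms(2,1)] by fastforce
  qed
  moreover have "sum_list (cycle_type A \<sigma>) = card A"
  proof -
    have "sum_list (cycle_type A \<sigma>) = sum_mset (mset (cycle_type A \<sigma>))"
      by (rule sum_mset_sum_list[symmetric])
    also have "\<dots> = (\<Sum>C\<in>orbit \<sigma> ` A. card C)"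
      by (simp add: mset_cycle_type sum_unfold_sum_mset)
    also have "\<dots> = (\<Sum>C\<in>orbit \<sigma> ` A. \<Sum>x | x \<in> A \<and> orbit \<sigma> x = C. 1)"
    proof (rule sum.cong[OF refl])
      fix C assume "C \<in> orbit \<sigma> ` A"
      then have "{x. x \<in> A \<and> orbit \<sigma> x = C} = C"
        using orbit_facts(1,2,4)[OF assms(2,1)] by blast
      then show "card C = (\<Sum>x | x \<in> A \<and> orbit \<sigma> x = C. 1)" by simp
    qed
    also have "\<dots> = (\<Sum>x\<in>A. 1)"
      using assms(1) by (intro sum.group) auto
    finally show ?thesis by simp
  qed
  ultimately show ?thesis by (simp add: partitions_def)
qed

lemma finite_partitions: "finite (partitions k)"
proof (rule finite_subset)
  show "partitions k \<subseteq> {\<rho>. set \<rho> \<subseteq> {..k} \<and> length \<rho> \<le> k}"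
  proof
    fix \<rho> assume "\<rho> \<in> partitions k"
    then have \<rho>: "0 \<notin> set \<rho>" "sum_list \<rho> = k" by (auto simp: partitions_def)
    have "length xs \<le> sum_list xs" if "0 \<notin> set xs" for xs :: "nat list"
      using that by (induction xs) auto
    then show "\<rho> \<in> {\<rho>. set \<rho> \<subseteq> {..k} \<and> length \<rho> \<le> k}"
      using \<rho> member_le_sum_list[of _ \<rho>] by auto
  qed
  show "finite {\<rho>. set \<rho> \<subseteq> {..k} \<and> length \<rho> \<le> k}"
    by (rule finite_lists_length_le) simp
qed

text \<open>The inverse of \<open>z_num\<close> is the class size divided by k!, so the sum over
  partitions unfolds into an average over permutations. The second assumption is there because
  \<open>char_at\<close> evaluates at an arbitrary member of the class.\<close>

lemma frob_ch_eq_sum: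
  fixes V :: "(complex, 'v) module"
  assumes tr: "\<And>\<sigma>. \<sigma> permutes {1..int k} \<Longrightarrow> vs_trace V (act \<sigma>) = \<chi> \<sigma>"
    and cf: "\<And>\<sigma> \<tau>. \<sigma> permutes {1..int k} \<Longrightarrow> \<tau> permutes {1..int k} \<Longrightarrow>
      cycle_type {1..int k} \<sigma> = cycle_type {1..int k} \<tau> \<Longrightarrow> \<chi> \<sigma> = \<chi> \<tau>"
  shows "frob_ch k V act = mscale (1 / fact k)
    (\<Sum>\<sigma> | \<sigma> permutes {1..int k}. mscale (\<chi> \<sigma>) (cycle_power_sum {1..int k} \<sigma>))"
proof -
  let ?A = "{1..int k}"
  let ?P = "{\<sigma>. \<sigma> permutes ?A}"
  let ?g = "\<lambda>\<sigma>. mscale (\<chi> \<sigma> / fact k) (cycle_power_sum ?A \<sigma>) :: complex mfps"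
  have "frob_ch k V act = (\<Sum>\<rho>\<in>partitions k. \<Sum>\<sigma> | \<sigma> \<in> ?P \<and> cycle_type ?A \<sigma> = \<rho>. ?g \<sigma>)"
    unfolding frob_ch_def
  proof (rule sum.cong[OF refl])
    fix \<rho> assume "\<rho> \<in> partitions k"
    have P: "perms_of_type k \<rho> = {\<sigma>. \<sigma> \<in> ?P \<and> cycle_type ?A \<sigma> = \<rho>}"
      by (simp add: perms_of_type_def)
    show "mscale (inverse (z_num k \<rho>) * char_at k V act \<rho>) (power_sums \<rho>) =
        (\<Sum>\<sigma> | \<sigma> \<in> ?P \<and> cycle_type ?A \<sigma> = \<rho>. ?g \<sigma>)"
    proof (cases "perms_of_type k \<rho> = {}")
      case True
      \<comment> \<open>Division by 0 yields 0 here, as does the inverse of 0, so a type without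
        permutations contributes nothing to either side. It therefore need not be shown that every
        partition occurs as a cycle type.\<close>
      then have "z_num k \<rho> = 0" by (simp add: z_num_def)
      then show ?thesis unfolding P[symmetric] True by simp
    next
      case False
      define \<tau> where "\<tau> = (SOME \<sigma>. \<sigma> \<in> perms_of_type k \<rho>)"
      have \<tau>: "\<tau> \<in> perms_of_type k \<rho>"
        unfolding \<tau>_def using False by (simp add: some_in_eq)
      have "?g \<sigma> = mscale (\<chi> \<tau> / fact k) (power_sums \<rho>)" if "\<sigma> \<in> perms_of_type k \<rho>" for \<sigma>
      proof -
        have "\<chi> \<sigma> = \<chi> \<tau>" using that \<tau> by (intro cf) (auto simp: perms_of_type_def)
        moreover have "(cycle_power_sum ?A \<sigma> :: complex mfps) = power_sums \<rho>"
          using that by (auto simp: perms_of_type_def power_sums_cycle_type)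
        ultimately show ?thesis by simp
      qed
      then have "(\<Sum>\<sigma>\<in>perms_of_type k \<rho>. ?g \<sigma>) =
          mscale (of_nat (card (perms_of_type k \<rho>)) * (\<chi> \<tau> / fact k)) (power_sums \<rho>)"
        by (simp add: mscale_of_nat[symmetric])
      moreover have "char_at k V act \<rho> = \<chi> \<tau>"
        unfolding char_at_def \<tau>_def[symmetric] using \<tau> by (intro tr) (simp add: perms_of_type_def)
      ultimately show ?thesis
        unfolding P[symmetric] by (simp add: z_num_def)
    qed
  qed
  also have "\<dots> = (\<Sum>\<sigma>\<in>?P. ?g \<sigma>)"
  proof -
    have "cycle_type ?A ` ?P \<subseteq> partitions k"
      using cycle_type_partitions[of ?A] by auto
    then show ?thesis
      using sum.group[OF finite_permutations[of ?A] finite_partitions, of "cycle_type ?A" k ?g] by simp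
  qed
  also have "\<dots> = mscale (1 / fact k) (\<Sum>\<sigma>\<in>?P. mscale (\<chi> \<sigma>) (cycle_power_sum ?A \<sigma>))"
    by (simp add: mscale_sum_right)
  finally show ?thesis .
qed

lemma op_trace_chain_act:
  assumes "finite A" "finite M"
  shows "op_trace (Delta A M i) (chain_act \<sigma>) =
    of_nat (card (weakly_increasing M i)) *
      (of_int (sign \<sigma>) * of_nat (card (injective_words (fixed_points A \<sigma>) i)))"
proof -
  let ?D = "Delta A M i"
  have fix_iff: "map \<sigma> w = w \<longleftrightarrow> (\<forall>x\<in>set w. \<sigma> x = x)" for w
    by (metis map_eq_conv map_ident)
  have "op_trace ?D (chain_act \<sigma>) = (\<Sum>s\<in>?D. if map \<sigma> (fst s) = fst s then of_int (sign \<sigma>) else 0)"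
    unfolding op_trace_def chain_act_linext
    by (intro sum.cong refl) (simp add: lookup_single when_def prod_eq_iff)
  also have "\<dots> = of_int (sign \<sigma>) * of_nat (card {s \<in> ?D. map \<sigma> (fst s) = fst s})"
    using finite_Delta[OF assms] by (simp add: sum.If_cases Int_def)
  also have "{s \<in> ?D. map \<sigma> (fst s) = fst s} =
      injective_words (fixed_points A \<sigma>) i \<times> weakly_increasing M i"
    by (auto simp: Delta_def fix_iff injective_words_def fixed_points_def weakly_increasing_def)
  finally show ?thesis by (simp add: card_cartesian_product)
qed

lemma frob_ch_chain_space:
  assumes "i \<le> k" "k \<le> n"
  shows "frob_ch k (chain_space {1..int k} {1..int n - int k + 1} i) chain_act =
    of_nat ((n - k + i) choose i) * (schur (replicate (k - i) 1) * schur [1] ^ i)"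
proof -
  let ?A = "{1..int k}" and ?M = "{1..int n - int k + 1}"
  let ?c = "of_nat ((n - k + i) choose i) :: complex"
  let ?\<chi> = "\<lambda>\<sigma>. of_int (sign \<sigma>) * of_nat (card (injective_words (fixed_points ?A \<sigma>) i)) :: complex"
  \<comment> \<open>There are n - k + 1 labels; with m = n - k + 1 the upper index m + i - 1 of the
    binomial becomes n - k + i.\<close>
  have "?M = {1..<1 + int (n - k + 1)}" using assms(2) by auto
  then have M: "card (weakly_increasing ?M i) = (n - k + i) choose i"
    using card_weakly_increasing[of 1 "n - k + 1" i] by simp
  have "frob_ch k (chain_space ?A ?M i) chain_act = mscale (1 / fact k)
      (\<Sum>\<sigma> | \<sigma> permutes ?A. mscale (?c * ?\<chi> \<sigma>) (cycle_power_sum ?A \<sigma>))"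
  proof (rule frob_ch_eq_sum)
    fix \<sigma> :: "int \<Rightarrow> int" assume "\<sigma> permutes ?A"
    then show "vs_trace (chain_space ?A ?M i) (chain_act \<sigma>) = ?c * ?\<chi> \<sigma>"
      using op_trace_chain_act[of ?A ?M i \<sigma>] M by (simp add: vs_trace_chain_space)
  next
    fix \<sigma> \<tau> :: "int \<Rightarrow> int"
    assume p: "\<sigma> permutes ?A" "\<tau> permutes ?A" and c: "cycle_type ?A \<sigma> = cycle_type ?A \<tau>"
    have "finite (fixed_points ?A \<sigma>)" "finite (fixed_points ?A \<tau>)"
      by (rule finite_subset[of _ ?A]; force simp: fixed_points_def)+
    moreover have "card (fixed_points ?A \<sigma>) = card (fixed_points ?A \<tau>)"
      using c by (simp add: card_fixed_points_eq p)
    ultimately show "?c * ?\<chi> \<sigma> = ?c * ?\<chi> \<tau>"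
      using sign_cycle_type[OF _ p c] by (simp add: card_injective_words)
  qed
  also have "\<dots> = mscale (1 / fact k * ?c)
      (\<Sum>\<sigma> | \<sigma> permutes ?A. mscale (?\<chi> \<sigma>) (cycle_power_sum ?A \<sigma>))"
    by (simp add: mscale_sum_right mult.assoc)
  also have "\<dots> = mscale ?c (schur (replicate (k - i) 1) * schur [1] ^ i)"
    using signed_sum_injective_words[of ?A i] assms(1) by simp
  finally show ?thesis by (simp add: mscale_of_nat)
qed

theorem theorem6p5:
  fixes n k :: nat
  assumes "0 < k" and "k \<le> n"
  shows "c_fun n k =
      (\<Sum>i=0..k. (-1) ^ (k - i) *
        frob_ch k (chain_space {1..int k} {1..int n - int k + 1} i) chain_act) \<and>
    (\<Sum>i=0..k. (-1) ^ (k - i) *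
        frob_ch k (chain_space {1..int k} {1..int n - int k + 1} i) chain_act) =
      frob_ch k (homology {1..int k} {1..int n - int k + 1} k) homology_act"
proof
  let ?A = "{1..int k}" and ?M = "{1..int n - int k + 1}"
  show "c_fun n k = (\<Sum>i=0..k. (-1) ^ (k - i) * frob_ch k (chain_space ?A ?M i) chain_act)"
    unfolding c_fun_def using assms(2)
    by (intro sum.cong refl) (simp add: frob_ch_chain_space mult.assoc)
  \<comment> \<open>\<open>char_at\<close> evaluates homology and all chain spaces at the same
    chosen permutation, so the trace identity for a single \<sigma> is enough.\<close>
  have hom: "char_at k (homology ?A ?M k) homology_act \<rho> =
      (\<Sum>i=0..k. (-1) ^ (k - i) * char_at k (chain_space ?A ?M i) chain_act \<rho>)"
    if "perms_of_type k \<rho> \<noteq> {}" for \<rho>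
  proof -
    have "(SOME \<sigma>. \<sigma> \<in> perms_of_type k \<rho>) \<in> perms_of_type k \<rho>"
      using that by (simp add: some_in_eq)
    then have "(SOME \<sigma>. \<sigma> \<in> perms_of_type k \<rho>) permutes ?A"
      by (simp add: perms_of_type_def)
    from vs_trace_homology[OF _ _ _ this, of ?M] show ?thesis
      using assms(2) by (simp add: char_at_def)
  qed
  have "(\<Sum>i=0..k. (-1) ^ (k - i) * frob_ch k (chain_space ?A ?M i) chain_act) =
      (\<Sum>\<rho>\<in>partitions k. \<Sum>i=0..k. mscale (inverse (z_num k \<rho>) *
        ((-1) ^ (k - i) * char_at k (chain_space ?A ?M i) chain_act \<rho>)) (power_sums \<rho>))"
    unfolding frob_ch_def
    by (subst sum.swap)
      (simp only: mscale_minus1_power[symmetric] mscale_sum_right mscale_mscale mult.left_commute)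
  also have "\<dots> = frob_ch k (homology ?A ?M k) homology_act"
    unfolding frob_ch_def
  proof (rule sum.cong[OF refl])
    fix \<rho>
    show "(\<Sum>i=0..k. mscale (inverse (z_num k \<rho>) *
        ((-1) ^ (k - i) * char_at k (chain_space ?A ?M i) chain_act \<rho>)) (power_sums \<rho>)) =
      mscale (inverse (z_num k \<rho>) * char_at k (homology ?A ?M k) homology_act \<rho>) (power_sums \<rho>)"
    proof (cases "perms_of_type k \<rho> = {}")
      case True
      then show ?thesis by (simp add: z_num_def)
    next
      case False
      then show ?thesis by (simp add: hom mscale_sum_left sum_distrib_left)
    qed
  qed
  finally show "(\<Sum>i=0..k. (-1) ^ (k - i) * frob_ch k (chain_space ?A ?M i) chain_act) =
      frob_ch k (homology ?A ?M k) homology_act" .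
qed

end
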